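(* Let $\mathcal{A}$ be a semi-simple commutative Banach algebra (over $\mathbb{C}$). Then every multiplier $T:\mathcal{A}\to\mathcal{A}$ obeys generalized Weyl's theorem.
   Context: A multiplier on $\mathcal{A}$ is a mapping $T:\mathcal{A}\to\mathcal{A}$ with $T(x)y=xT(y)$ for all $x,y\in\mathcal{A}$; by semi-simplicity, every multiplier is automatically a bounded linear operator on $\mathcal{A}$. For a bounded operator $T$ and an integer $n\ge0$, $T_{[n]}$ is the restriction of $T$ to its range $R(T^n)$, viewed as a map $R(T^n)\to R(T^n)$; $T$ is B-Fredholm if for some $n\ge 0$, $R(T^n)$ is closed and $T_{[n]}$ is Fredholm, and then its index is that of $T_{[n]}$ (independent of such $n$). $T$ is B-Weyl if it is B-Fredholm of index $0$, and $\sigma_{BW}(T)=\{\lambda\in\mathbb{C}: T-\lambda I\text{ is not B-Weyl}\}$. $E(T)$ is the set of eigenvalues of $T$ that are isolated points of $\sigma(T)$. $T$ obeys generalized Weyl's theorem if $\sigma(T)\setminus E(T)=\sigma_{BW}(T)$. *)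

theory Defs
  imports "HOL-Analysis.Analysis"
begin

text \<open>
  The distribution only has real normed algebras.  A complex structure is added on top of the
  real one; algebras are not assumed to be unital.
\<close>

class scaleC = scaleR +
  fixes scaleC :: "complex \<Rightarrow> 'a \<Rightarrow> 'a" (infixr "*\<^sub>C" 75)
  assumes scaleR_scaleC: "scaleR r x = complex_of_real r *\<^sub>C x"

class complex_vector = scaleC + ab_group_add +
  assumes scaleC_add_right: "a *\<^sub>C (x + y) = a *\<^sub>C x + a *\<^sub>C y"
    and scaleC_add_left: "(a + b) *\<^sub>C x = a *\<^sub>C x + b *\<^sub>C x"
    and scaleC_scaleC: "a *\<^sub>C b *\<^sub>C x = (a * b) *\<^sub>C x"
    and scaleC_one: "1 *\<^sub>C x = x"

global_interpretation complex_vector: vector_space "scaleC :: complex \<Rightarrow> 'a \<Rightarrow> 'a::complex_vector"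
  by unfold_locales (simp_all add: scaleC_add_right scaleC_add_left scaleC_scaleC scaleC_one)

class complex_normed_vector = complex_vector + real_normed_vector +
  assumes norm_scaleC: "norm (a *\<^sub>C x) = cmod a * norm x"

class complex_normed_algebra = complex_normed_vector + real_normed_algebra +
  assumes mult_scaleC_left: "(a *\<^sub>C x) * y = a *\<^sub>C (x * y)"
    and mult_scaleC_right: "x * (a *\<^sub>C y) = a *\<^sub>C (x * y)"

class complex_comm_banach_algebra = complex_normed_algebra + comm_ring + banach

subsection \<open>Semi-simplicity and multipliers\<close>

definition algebra_ideal :: "'a::complex_comm_banach_algebra set \<Rightarrow> bool" where
  "algebra_ideal J \<longleftrightarrow> complex_vector.subspace J \<and> (\<forall>a. \<forall>x\<in>J. a * x \<in> J)"

definition modular_ideal :: "'a::complex_comm_banach_algebra set \<Rightarrow> bool" where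
  "modular_ideal J \<longleftrightarrow> algebra_ideal J \<and> (\<exists>u. \<forall>x. x - u * x \<in> J)"

definition maximal_modular_ideal :: "'a::complex_comm_banach_algebra set \<Rightarrow> bool" where
  "maximal_modular_ideal J \<longleftrightarrow> modular_ideal J \<and> J \<noteq> UNIV \<and>
     (\<forall>K. algebra_ideal K \<and> J \<subseteq> K \<longrightarrow> K = J \<or> K = UNIV)"

text \<open>If there are no maximal modular ideals, the radical is the whole algebra.\<close>

definition jacobson_radical :: "'a::complex_comm_banach_algebra set" where
  "jacobson_radical = \<Inter> {J. maximal_modular_ideal J}"

definition semisimple :: "'a::complex_comm_banach_algebra itself \<Rightarrow> bool" where
  "semisimple _ \<longleftrightarrow> (jacobson_radical :: 'a set) = {0}"

definition multiplier :: "('a::complex_comm_banach_algebra \<Rightarrow> 'a) \<Rightarrow> bool" where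
  "multiplier T \<longleftrightarrow> (\<forall>x y. T x * y = x * T y)"

subsection \<open>Spectrum\<close>

definition bounded_clinear ::
  "('a::complex_normed_vector \<Rightarrow> 'b::complex_normed_vector) \<Rightarrow> bool" where
  "bounded_clinear T \<longleftrightarrow> bounded_linear T \<and> (\<forall>c x. T (c *\<^sub>C x) = c *\<^sub>C T x)"

definition op_shift :: "('a::complex_vector \<Rightarrow> 'a) \<Rightarrow> complex \<Rightarrow> 'a \<Rightarrow> 'a" where
  "op_shift T \<mu> = (\<lambda>x. T x - \<mu> *\<^sub>C x)"

definition op_invertible :: "('a::complex_normed_vector \<Rightarrow> 'a) \<Rightarrow> bool" where
  "op_invertible T \<longleftrightarrow> (\<exists>S. bounded_clinear S \<and> S \<circ> T = id \<and> T \<circ> S = id)"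

definition op_spectrum :: "('a::complex_normed_vector \<Rightarrow> 'a) \<Rightarrow> complex set" where
  "op_spectrum T = {\<mu>. \<not> op_invertible (op_shift T \<mu>)}"

definition eigenvalue :: "('a::complex_vector \<Rightarrow> 'a) \<Rightarrow> complex \<Rightarrow> bool" where
  "eigenvalue T \<mu> \<longleftrightarrow> (\<exists>x. x \<noteq> 0 \<and> T x = \<mu> *\<^sub>C x)"

definition isolated_eigenvalues :: "('a::complex_normed_vector \<Rightarrow> 'a) \<Rightarrow> complex set" where
  "isolated_eigenvalues T = {\<mu>. eigenvalue T \<mu> \<and> \<mu> isolated_in op_spectrum T}"

subsection \<open>B-Fredholm and B-Weyl operators\<close>

definition finite_dim :: "'a::complex_vector set \<Rightarrow> bool" where
  "finite_dim V \<longleftrightarrow> (\<exists>B. finite B \<and> V \<subseteq> complex_vector.span B)"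

definition alg_complement ::
  "'a::complex_vector set \<Rightarrow> 'a set \<Rightarrow> 'a set \<Rightarrow> bool" where
  "alg_complement V W U \<longleftrightarrow> complex_vector.subspace U \<and> W \<inter> U = {0} \<and>
     {w + u | w u. w \<in> W \<and> u \<in> U} = V"

text \<open>
  For subspaces \<open>W \<subseteq> V\<close>, every algebraic complement of \<open>W\<close> in \<open>V\<close> is isomorphic to \<open>V / W\<close>,
  so its dimension is the codimension of \<open>W\<close> in \<open>V\<close>.
\<close>

definition finite_codim :: "'a::complex_vector set \<Rightarrow> 'a set \<Rightarrow> bool" where
  "finite_codim V W \<longleftrightarrow> (\<exists>U. alg_complement V W U \<and> finite_dim U)"

definition codim :: "'a::complex_vector set \<Rightarrow> 'a set \<Rightarrow> nat" where
  "codim V W = complex_vector.dim (SOME U. alg_complement V W U)"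

text \<open>
  The next two notions concern the restriction of \<open>T\<close> to a \<open>T\<close>-invariant subspace \<open>V\<close>, as a map
  from \<open>V\<close> to \<open>V\<close>.  They are applied only to closed \<open>V\<close>; then the range of a bounded operator
  is closed as soon as it has finite codimension.
\<close>

definition fredholm_on :: "'a::complex_vector set \<Rightarrow> ('a \<Rightarrow> 'a) \<Rightarrow> bool" where
  "fredholm_on V T \<longleftrightarrow> finite_dim {x \<in> V. T x = 0} \<and> finite_codim V (T ` V)"

definition fredholm_index_on :: "'a::complex_vector set \<Rightarrow> ('a \<Rightarrow> 'a) \<Rightarrow> int" where
  "fredholm_index_on V T =
     int (complex_vector.dim {x \<in> V. T x = 0}) - int (codim V (T ` V))"

definition b_fredholm_at :: "('a::complex_normed_vector \<Rightarrow> 'a) \<Rightarrow> nat \<Rightarrow> bool" where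
  "b_fredholm_at T n \<longleftrightarrow> closed (range (T ^^ n)) \<and> fredholm_on (range (T ^^ n)) T"

definition b_fredholm :: "('a::complex_normed_vector \<Rightarrow> 'a) \<Rightarrow> bool" where
  "b_fredholm T \<longleftrightarrow> (\<exists>n. b_fredholm_at T n)"

text \<open>
  For a bounded operator the index does not depend on the choice of \<open>n\<close> with
  \<open>b_fredholm_at T n\<close>; the least such \<open>n\<close> is used.
\<close>

definition b_fredholm_index :: "('a::complex_normed_vector \<Rightarrow> 'a) \<Rightarrow> int" where
  "b_fredholm_index T = fredholm_index_on (range (T ^^ (LEAST n. b_fredholm_at T n))) T"

definition b_weyl :: "('a::complex_normed_vector \<Rightarrow> 'a) \<Rightarrow> bool" where
  "b_weyl T \<longleftrightarrow> b_fredholm T \<and> b_fredholm_index T = 0"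

definition b_weyl_spectrum :: "('a::complex_normed_vector \<Rightarrow> 'a) \<Rightarrow> complex set" where
  "b_weyl_spectrum T = {\<mu>. \<not> b_weyl (op_shift T \<mu>)}"

definition generalized_weyl :: "('a::complex_normed_vector \<Rightarrow> 'a) \<Rightarrow> bool" where
  "generalized_weyl T \<longleftrightarrow> op_spectrum T - isolated_eigenvalues T = b_weyl_spectrum T"

end

theory Submission
  imports Defs
begin

text \<open>
  For a multiplier \<open>S = T - \<lambda>I\<close> semi-simplicity gives \<open>ker S \<inter> S(A) = 0\<close>, because
  \<open>(Sx)(Sx) = x S(Sx)\<close> and there are no nilpotents.  Both being B-Weyl and ``\<open>S\<close> is invertible, or
  \<open>0\<close> is an isolated point of the spectrum of \<open>S\<close>'' turn out to be equivalent to
  \<open>A = ker S + S(A)\<close>.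

  If \<open>S\<close> is B-Weyl, a dimension count on \<open>S\<^sup>n(A)\<close>, where the kernel of \<open>S\<close> vanishes as soon as
  \<open>n > 0\<close>, gives the decomposition.  Given the decomposition, the inverse of \<open>S\<close> on its range extends
  by zero to a multiplier \<open>G\<close>, and a Neumann series in \<open>G\<close> inverts \<open>S - z\<close> for small \<open>z \<noteq> 0\<close>.
  Conversely, suppose that \<open>0\<close> is isolated in the spectrum, with resolvent \<open>R(z) = (S - z)\<^sup>-\<^sup>1\<close>.  The
  integrals of \<open>z\<^sup>j R(z)x\<close> over circles about \<open>0\<close> do not depend on the radius; for \<open>j = 0, 1\<close>,
  suitably normalised, they yield \<open>p\<close> and \<open>q\<close> with \<open>Sp = x + q\<close> and \<open>\<parallel>S\<^sup>n q\<parallel> \<le> C r\<^sup>n\<close> for every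
  \<open>r > 0\<close>.  Hence \<open>Sq\<close> lies in the radical, so \<open>Sq = 0\<close> and \<open>x = -q + Sp\<close>.
\<close>

subsection \<open>The closed graph theorem\<close>

text \<open>By Baire, some sublevel set \<open>A n\<close> is dense in a ball. Differences of its
  points approximate every vector to within half its norm, with controlled image. Iterating this
  writes \<open>x\<close> as a series whose image converges absolutely, and the closed graph
  identifies the sum with \<open>f x\<close>. This makes every multiplier bounded.\<close>

lemma closed_graph_theorem:
  fixes f :: "'a::banach \<Rightarrow> 'b::banach"
  assumes "linear f"
    and closed: "\<And>X x y. X \<longlonglongrightarrow> x \<Longrightarrow> (\<lambda>n. f (X n)) \<longlonglongrightarrow> y \<Longrightarrow> f x = y"
  shows "bounded_linear f"
proof -
  interpret f: linear f by fact
  define A where "A n = {x. norm (f x) \<le> real n}" for n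
  have "\<Union> (range (\<lambda>n. closure (A n))) = UNIV"
  proof -
    have "x \<in> A (nat \<lceil>norm (f x)\<rceil>)" for x
      unfolding A_def by (simp add: of_nat_nat)
    then show ?thesis using closure_subset by blast
  qed
  moreover have "interior (\<Union> (range (\<lambda>n. closure (A n)))) = {}"
    if "\<And>n. interior (closure (A n)) = {}"
  proof -
    have "Met_TC.mtopology interior_of \<Union> (range (\<lambda>n. closure (A n))) = {}"
    proof (rule Met_TC.metric_Baire_category_alt)
      show "Met_TC.mcomplete TYPE('a)" unfolding mcomplete_iff_complete by (rule complete_UNIV)
    next
      fix T assume "T \<in> range (\<lambda>n. closure (A n))"
      then obtain n where T: "T = closure (A n)" by blast
      show "closedin Met_TC.mtopology T \<and> Met_TC.mtopology interior_of T = {}"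
        unfolding T using that[of n] by simp
    qed simp
    then show ?thesis by simp
  qed
  ultimately obtain n where "interior (closure (A n)) \<noteq> {}"
    by fastforce
  then obtain p where "p \<in> interior (closure (A n))" by blast
  then obtain r where r: "r > 0" "cball p r \<subseteq> closure (A n)"
    unfolding mem_interior_cball by blast
  define M where "M = real n / r"
  have step: "\<exists>a. norm (f a) \<le> M * norm x \<and> norm (x - a) \<le> norm x / 2" for x
  proof (cases "x = 0")
    case True
    then show ?thesis by (intro exI[of _ 0]) (simp add: f.zero)
  next
    case False
    \<comment> \<open>\<open>v\<close> is \<open>x\<close> rescaled so that \<open>p + v\<close> and
      \<open>p - v\<close> stay in the ball. Half the difference of approximants from
      \<open>A n\<close> cancels the centre \<open>p\<close> and keeps the image bound
      \<open>real n\<close>.\<close>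
    define v where "v = (r / norm x) *\<^sub>R x"
    have nv: "norm v = r" using False r by (simp add: v_def)
    have "p + v \<in> closure (A n)" "p - v \<in> closure (A n)"
      using r nv by (auto simp: dist_norm intro!: subsetD[OF r(2)])
    then obtain a b where ab: "a \<in> A n" "b \<in> A n" "dist a (p + v) < r/2" "dist b (p - v) < r/2"
      using r(1) by (meson closure_approachable half_gt_zero)
    define c where "c = (1/2) *\<^sub>R (a - b)"
    have "norm (v - c) \<le> r / 2"
    proof -
      have "v - c = (1/2) *\<^sub>R (((p + v) - a) - ((p - v) - b))"
        by (simp add: c_def algebra_simps flip: scaleR_add_left)
      then have "norm (v - c) = norm (((p + v) - a) - ((p - v) - b)) / 2"
        by simp
      also have "\<dots> \<le> (norm ((p + v) - a) + norm ((p - v) - b)) / 2"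
        by (intro divide_right_mono norm_triangle_ineq4) auto
      finally show ?thesis using ab(3,4) by (simp add: dist_norm norm_minus_commute)
    qed
    moreover have "norm (f c) \<le> real n"
    proof -
      have "norm (f c) = norm (f a - f b) / 2" by (simp add: c_def f.scaleR f.diff)
      also have "\<dots> \<le> (norm (f a) + norm (f b)) / 2"
        by (intro divide_right_mono norm_triangle_ineq4) auto
      finally show ?thesis using ab(1,2) by (simp add: A_def)
    qed
    ultimately show ?thesis
    proof (intro exI[of _ "(norm x / r) *\<^sub>R c"] conjI)
      assume vc: "norm (v - c) \<le> r / 2" and fc: "norm (f c) \<le> real n"
      show "norm (f ((norm x / r) *\<^sub>R c)) \<le> M * norm x"
        using mult_left_mono[OF fc, of "norm x / r"] r by (simp add: f.scaleR M_def field_simps)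
      have "x - (norm x / r) *\<^sub>R c = (norm x / r) *\<^sub>R (v - c)"
        using False r by (simp add: v_def scaleR_diff_right)
      then have "norm (x - (norm x / r) *\<^sub>R c) = (norm x / r) * norm (v - c)"
        using r by simp
      also have "\<dots> \<le> (norm x / r) * (r / 2)"
        using vc r by (intro mult_left_mono) auto
      finally show "norm (x - (norm x / r) *\<^sub>R c) \<le> norm x / 2"
        using r by simp
    qed
  qed
  then obtain a where a: "\<And>x. norm (f (a x)) \<le> M * norm x" "\<And>x. norm (x - a x) \<le> norm x / 2"
    by metis
  have M: "M \<ge> 0" using r by (simp add: M_def)
  have "norm (f x) \<le> norm x * (M * 2)" for x
  proof -
    \<comment> \<open>\<open>X k\<close> is the remainder after \<open>k\<close> approximations, so
      the terms \<open>a (X k)\<close> telescope towards \<open>x\<close>.\<close>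
    define X where "X k = ((\<lambda>x. x - a x) ^^ k) x" for k
    have X: "norm (X k) \<le> norm x * (1/2) ^ k" for k
    proof (induction k)
      case (Suc k)
      then show ?case using a(2)[of "X k"] by (simp add: X_def)
    qed (simp add: X_def)
    have "(\<lambda>k. norm x * (1/2) ^ k) \<longlonglongrightarrow> norm x * 0"
      by (intro tendsto_intros LIMSEQ_realpow_zero) auto
    then have X0: "X \<longlonglongrightarrow> 0"
      using X by (intro Lim_null_comparison[of X "\<lambda>k. norm x * (1/2) ^ k"]) auto
    have sumX: "(\<Sum>k<m. a (X k)) = x - X m" for m
      by (induction m) (auto simp: X_def)
    have fa: "norm (f (a (X k))) \<le> norm x * M * (1/2) ^ k" for k
      using a(1)[of "X k"] mult_left_mono[OF X[of k] M] by (simp add: mult_ac)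
    have geo: "(\<lambda>k. norm x * M * (1/2) ^ k) sums (norm x * M * 2)"
      using geometric_sums[of "1/2::real"] sums_mult by fastforce
    have sf: "summable (\<lambda>k. norm (f (a (X k))))"
      using fa by (intro summable_comparison_test'[OF sums_summable[OF geo], of 0]) simp
    have "(\<lambda>m. \<Sum>k<m. f (a (X k))) \<longlonglongrightarrow> (\<Sum>k. f (a (X k)))"
      by (rule summable_LIMSEQ[OF summable_norm_cancel[OF sf]])
    moreover have "(\<Sum>k<m. f (a (X k))) = f (x - X m)" for m
      unfolding sumX[symmetric] f.sum ..
    moreover have "(\<lambda>m. x - X m) \<longlonglongrightarrow> x - 0" by (intro tendsto_intros X0)
    ultimately have "f x = (\<Sum>k. f (a (X k)))"
      by (intro closed[of "\<lambda>m. x - X m"]) auto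
    also have "norm \<dots> \<le> (\<Sum>k. norm (f (a (X k))))" by (rule summable_norm[OF sf])
    also have "\<dots> \<le> (\<Sum>k. norm x * M * (1/2) ^ k)"
      by (rule suminf_le[OF fa sf sums_summable[OF geo]])
    also have "\<dots> = norm x * (M * 2)" using geo by (simp add: sums_iff)
    finally show ?thesis .
  qed
  then show ?thesis by (intro bounded_linear_intro f.add f.scaleR)
qed

subsection \<open>Dimensions of complements\<close>

text \<open>Send each \<open>d\<close> in \<open>D\<close> to a \<open>U\<close>-component modulo
  \<open>W\<close> and extend linearly to \<open>g\<close>. As \<open>K\<close> meets
  \<open>W\<close> trivially, \<open>g\<close> is injective on the span of \<open>D\<close>. If the
  cardinalities agree, the image of \<open>D\<close> spans \<open>U\<close>, and
  \<open>u = g k\<close> differs from \<open>k\<close> by an element of \<open>W\<close>. An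
  arbitrary independent \<open>D\<close> is used because \<open>K\<close> is not yet known to be
  finite-dimensional.\<close>

lemma complement_basis_card:
  fixes U V W :: "'a::complex_vector set"
  assumes "complex_vector.subspace K" "complex_vector.subspace W" "complex_vector.subspace U"
    and KW: "K \<inter> W = {0}" and sub: "K \<subseteq> {w + u | w u. w \<in> W \<and> u \<in> U}" and fin: "finite_dim U"
    and D: "D \<subseteq> K" "complex_vector.independent D"
  shows "finite D" "card D \<le> complex_vector.dim U"
    "card D = complex_vector.dim U \<Longrightarrow> U \<subseteq> {w + k | w k. w \<in> W \<and> k \<in> K}"
proof -
  interpret p: vector_space_pair "scaleC :: complex \<Rightarrow> 'a \<Rightarrow> 'a" "scaleC :: complex \<Rightarrow> 'a \<Rightarrow> 'a"
    by unfold_locales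
  have "\<forall>d\<in>D. \<exists>u\<in>U. d - u \<in> W"
  proof
    fix d assume "d \<in> D"
    then obtain w u where "w \<in> W" "u \<in> U" "d = w + u" using sub D(1) by blast
    then show "\<exists>u\<in>U. d - u \<in> W" by (intro bexI[of _ u]) auto
  qed
  then obtain h where h: "\<And>d. d \<in> D \<Longrightarrow> h d \<in> U \<and> d - h d \<in> W" by metis
  obtain g where g: "Vector_Spaces.linear scaleC scaleC g" "\<And>d. d \<in> D \<Longrightarrow> g d = h d"
    using p.linear_independent_extend[OF D(2), of h] by blast
  interpret g: Vector_Spaces.linear "scaleC :: complex \<Rightarrow> 'a \<Rightarrow> 'a" "scaleC :: complex \<Rightarrow> 'a \<Rightarrow> 'a" g
    by (rule g(1))
  have gW: "k - g k \<in> W" if "k \<in> complex_vector.span D" for k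
  proof -
    have "complex_vector.subspace {k. k - g k \<in> W}"
    proof (rule complex_vector.subspaceI)
      fix x y assume "x \<in> {k. k - g k \<in> W}" "y \<in> {k. k - g k \<in> W}"
      then have "(x - g x) + (y - g y) \<in> W" using assms(2) by (simp add: complex_vector.subspace_add)
      then show "x + y \<in> {k. k - g k \<in> W}" by (simp add: g.add algebra_simps)
    next
      fix c x assume "x \<in> {k. k - g k \<in> W}"
      then have "c *\<^sub>C (x - g x) \<in> W" using assms(2) by (simp add: complex_vector.subspace_scale)
      then show "c *\<^sub>C x \<in> {k. k - g k \<in> W}" by (simp add: g.scale complex_vector.scale_right_diff_distrib)
    qed (use assms(2) in \<open>auto simp: complex_vector.subspace_0\<close>)
    moreover have "D \<subseteq> {k. k - g k \<in> W}" using h g(2) by auto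
    ultimately show ?thesis
      using complex_vector.span_minimal[of D "{k. k - g k \<in> W}"] that by blast
  qed
  have spanK: "complex_vector.span D \<subseteq> K"
    using D(1) assms(1) by (rule complex_vector.span_minimal)
  have inj: "inj_on g (complex_vector.span D)"
    unfolding g.inj_on_iff_eq_0[OF complex_vector.subspace_span]
  proof (intro ballI impI)
    fix k assume "k \<in> complex_vector.span D" "g k = 0"
    then have "k \<in> K \<inter> W" using gW[of k] spanK by auto
    then show "k = 0" using KW by simp
  qed
  have ind: "complex_vector.independent (g ` D)"
    using p.linear_independent_injective_image[OF g(1) D(2) inj] .
  have gDU: "g ` D \<subseteq> U" using h g(2) by auto
  have injD: "inj_on g D" by (rule inj_on_subset[OF inj complex_vector.span_superset])
  obtain F where F: "finite F" "U \<subseteq> complex_vector.span F" using fin by (auto simp: finite_dim_def)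
  obtain C where C: "C \<subseteq> U" "complex_vector.independent C" "U \<subseteq> complex_vector.span C"
    "card C = complex_vector.dim U"
    using complex_vector.basis_exists by blast
  \<comment> \<open>An infinite set has \<open>card\<close> 0 by default, so finiteness must be
    secured before counting.\<close>
  have finC: "finite C"
    using complex_vector.independent_span_bound[OF F(1) C(2)] C(1) F(2) by blast
  have bound: "finite E \<and> card E \<le> complex_vector.dim U" if "E \<subseteq> U" "complex_vector.independent E" for E
    using complex_vector.independent_span_bound[OF finC that(2)] that(1) C by auto
  show fD: "finite D" using bound[OF gDU ind] injD finite_imageD by blast
  show "card D \<le> complex_vector.dim U" using bound[OF gDU ind] injD by (simp add: card_image)
  assume eq: "card D = complex_vector.dim U"
  show "U \<subseteq> {w + k | w k. w \<in> W \<and> k \<in> K}"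
  proof
    fix u assume u: "u \<in> U"
    have "u \<in> complex_vector.span (g ` D)"
    proof (rule ccontr)
      \<comment> \<open>Otherwise adding \<open>u\<close> to the image of \<open>D\<close> gives
        \<open>dim U + 1\<close> independent vectors inside \<open>U\<close>.\<close>
      assume n: "u \<notin> complex_vector.span (g ` D)"
      then have "complex_vector.independent (insert u (g ` D))"
        using ind by (rule complex_vector.independent_insertI)
      moreover have "u \<notin> g ` D" using n complex_vector.span_base[of u "g ` D"] by argo
      ultimately show False
        using bound[of "insert u (g ` D)"] gDU u fD injD eq by (simp add: card_image)
    qed
    then obtain k where k: "k \<in> complex_vector.span D" "u = g k"
      using g.span_image[of D] by auto
    have "- (k - g k) \<in> W" using gW[OF k(1)] assms(2) by (rule complex_vector.subspace_neg[rotated])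
    moreover have "u = - (k - g k) + k" using k by simp
    ultimately show "u \<in> {w + k | w k. w \<in> W \<and> k \<in> K}" using k(1) spanK by blast
  qed
qed

text \<open>This compares the kernel with a complement of the range. Inequalities in both directions
  give index 0; conversely, equal dimensions give back a decomposition.\<close>

lemma complement_dim_le:
  fixes U W K :: "'a::complex_vector set"
  assumes "complex_vector.subspace K" "complex_vector.subspace W" "complex_vector.subspace U"
    and "K \<inter> W = {0}" "K \<subseteq> {w + u | w u. w \<in> W \<and> u \<in> U}" "finite_dim U"
  shows "finite_dim K" "complex_vector.dim K \<le> complex_vector.dim U"
    "complex_vector.dim K = complex_vector.dim U \<Longrightarrow> U \<subseteq> {w + k | w k. w \<in> W \<and> k \<in> K}"
proof -
  obtain C where C: "C \<subseteq> K" "complex_vector.independent C" "K \<subseteq> complex_vector.span C"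
    "card C = complex_vector.dim K"
    using complex_vector.basis_exists by blast
  note * = complement_basis_card[OF assms C(1,2)]
  show "finite_dim K" using *(1) C(3) by (auto simp: finite_dim_def)
  show "complex_vector.dim K \<le> complex_vector.dim U" using *(2) C(4) by simp
  show "complex_vector.dim K = complex_vector.dim U \<Longrightarrow> U \<subseteq> {w + k | w k. w \<in> W \<and> k \<in> K}"
    using *(3) C(4) by simp
qed

lemma alg_complementD:
  assumes "alg_complement V W U"
  shows "complex_vector.subspace U" "W \<inter> U = {0}" "{w + u | w u. w \<in> W \<and> u \<in> U} = V"
  using assms by (simp_all only: alg_complement_def)

lemma alg_complement_self_iff:
  fixes V :: "'a::complex_vector set"
  assumes "complex_vector.subspace V"
  shows "alg_complement V V U \<longleftrightarrow> U = {0}"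
proof
  assume U: "alg_complement V V U"
  have "0 \<in> V" using assms by (rule complex_vector.subspace_0)
  have "u \<in> V" if "u \<in> U" for u
  proof -
    have "0 + u \<in> {w + u | w u. w \<in> V \<and> u \<in> U}" using \<open>0 \<in> V\<close> that by blast
    then show ?thesis using alg_complementD(3)[OF U] by simp
  qed
  then show "U = {0}" using U by (auto simp: alg_complement_def)
next
  assume "U = {0}"
  then show "alg_complement V V U"
    using complex_vector.subspace_0[OF assms] complex_vector.subspace_single_0
    by (auto simp: alg_complement_def)
qed

text \<open>\<open>codim\<close> is computed from a complement picked by choice, possibly not the
  given finite-dimensional one. Comparing the two shows that the chosen one is finite-dimensional as
  well.\<close>

lemma codim_complement:
  fixes V W U :: "'a::complex_vector set"
  assumes W: "complex_vector.subspace W" and U: "alg_complement V W U" "finite_dim U"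
  obtains U' where "alg_complement V W U'" "finite_dim U'" "codim V W = complex_vector.dim U'"
proof -
  define U' where "U' = (SOME U. alg_complement V W U)"
  have U': "alg_complement V W U'" unfolding U'_def using U(1) by (rule someI)
  have sub: "u \<in> V" if "u \<in> U'" for u
  proof -
    have "0 + u \<in> {w + u | w u. w \<in> W \<and> u \<in> U'}"
      using complex_vector.subspace_0[OF W] that by blast
    then show ?thesis using alg_complementD(3)[OF U'] by simp
  qed
  have "finite_dim U'"
  proof (rule complement_dim_le(1)[of U' W U])
    show "U' \<subseteq> {w + u | w u. w \<in> W \<and> u \<in> U}"
      using U(1) sub by (auto simp: alg_complement_def)
  qed (use U U' W in \<open>auto simp: alg_complement_def Int_commute\<close>)
  then show ?thesis using that[OF U'] by (simp add: codim_def U'_def)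
qed

lemma dim_zero_singleton: "complex_vector.dim {0::'a::complex_vector} = 0"
  using complex_vector.dim_le_card[of "{0::'a}" "{}"] by simp

lemma finite_dim_zero: "finite_dim {0::'a::complex_vector}"
  unfolding finite_dim_def by (intro exI[of _ "{}"]) simp

subsection \<open>The radical\<close>

text \<open>If a maximal modular ideal \<open>J\<close> misses \<open>y\<close>, then
  \<open>J\<close> and the multiples of \<open>y\<close> fill the algebra, so the modular unit
  \<open>u\<close> is congruent to some \<open>b = a * y\<close>. Summability makes 1 - b invertible
  in the unitization, which forces every element into \<open>J\<close>. Without a unit, powers have
  to start at exponent 1: the n-th iterate is the power of \<open>a * y\<close> with exponent n +
  1.\<close>

lemma quasinilpotent_in_radical:
  fixes y :: "'a::complex_comm_banach_algebra"
  assumes summ: "\<And>a. summable (\<lambda>n. norm ((((*) (a * y)) ^^ n) (a * y)))"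
  shows "y \<in> jacobson_radical"
  unfolding jacobson_radical_def
proof
  fix J :: "'a set" assume "J \<in> {J. maximal_modular_ideal J}"
  then have max: "J \<noteq> UNIV" "\<And>K. algebra_ideal K \<Longrightarrow> J \<subseteq> K \<Longrightarrow> K = J \<or> K = UNIV"
    and "modular_ideal J"
    by (auto simp: maximal_modular_ideal_def)
  then obtain u where u: "\<And>x. x - u * x \<in> J" and subJ: "complex_vector.subspace J"
    and idJ: "\<And>a x. x \<in> J \<Longrightarrow> a * x \<in> J"
    by (auto simp: modular_ideal_def algebra_ideal_def)
  note J = complex_vector.subspace_0[OF subJ] complex_vector.subspace_add[OF subJ]
    complex_vector.subspace_scale[OF subJ]
  show "y \<in> J"
  proof (rule ccontr)
    assume y: "y \<notin> J"
    define K where "K = {j + a * y | j a. j \<in> J}"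
    have KI: "z \<in> K" if "j \<in> J" "z = j + a * y" for z j a
      using that by (auto simp: K_def)
    have "algebra_ideal K"
      unfolding algebra_ideal_def
    proof (intro conjI allI ballI complex_vector.subspaceI)
      show "0 \<in> K" using J(1) by (rule KI[where a = 0]) simp
    next
      fix v w assume "v \<in> K" "w \<in> K"
      then obtain j a k b where *: "j \<in> J" "v = j + a * y" "k \<in> J" "w = k + b * y"
        by (auto simp: K_def)
      show "v + w \<in> K"
        using J(2)[OF *(1,3)] by (rule KI[where a = "a + b"]) (simp add: * algebra_simps)
    next
      fix c v assume "v \<in> K"
      then obtain j a where *: "j \<in> J" "v = j + a * y" by (auto simp: K_def)
      show "c *\<^sub>C v \<in> K"
        using J(3)[OF *(1), of c] by (rule KI[where a = "c *\<^sub>C a"])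
          (simp add: * scaleC_add_right mult_scaleC_left)
    next
      fix b v assume "v \<in> K"
      then obtain j a where *: "j \<in> J" "v = j + a * y" by (auto simp: K_def)
      show "b * v \<in> K"
        using idJ[OF *(1), of b] by (rule KI[where a = "b * a"]) (simp add: * algebra_simps)
    qed
    moreover have "J \<subseteq> K" using KI[where a = 0] by auto
    moreover have "K \<noteq> J"
    proof
      assume "K = J"
      then have "u * y \<in> J" using KI[OF J(1), of "u * y" u] by simp
      then have "(y - u * y) + u * y \<in> J" using u[of y] J(2) by blast
      then show False using y by simp
    qed
    ultimately have "K = UNIV" using max(2) by blast
    then obtain j a where ja: "j \<in> J" "u = j + a * y" unfolding K_def by blast
    define b where "b = a * y"
    \<comment> \<open>\<open>c\<close> is b + b^2 + ..., that is, (1 - b)^(-1) - 1 in the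
      unitization.\<close>
    define c where "c = (\<Sum>n. (((*) b) ^^ n) b)"
    have sb: "summable (\<lambda>n. (((*) b) ^^ n) b)"
      using summable_norm_cancel[OF summ[of a]] by (simp add: b_def)
    have "c = b + (\<Sum>n. b * (((*) b) ^^ n) b)"
      using suminf_split_head[OF sb] by (simp add: c_def)
    also have "(\<Sum>n. b * (((*) b) ^^ n) b) = b * c"
      unfolding c_def using sb by (rule suminf_mult)
    finally have c: "c = b + b * c" .
    have "x \<in> J" for x
    proof -
      \<comment> \<open>\<open>x'\<close> is (1 - b)^(-1) x, so \<open>x = x' - b * x'\<close>, and
        modulo \<open>J\<close> the factor \<open>b\<close> may be replaced by
        \<open>u\<close>.\<close>
      define x' where "x' = x + c * x"
      have "(x' - u * x') + x' * (u - b) = x + (c - (b + b * c)) * x"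
        by (simp add: x'_def algebra_simps)
      then have "x = (x' - u * x') + x' * j" using c ja by (simp add: b_def)
      then show ?thesis using J(2)[OF u[of x'] idJ[OF ja(1), of x']] by simp
    qed
    then show False using max(1) by blast
  qed
qed

subsection \<open>Multipliers\<close>

lemma multiplier_swap: "multiplier S \<Longrightarrow> S x * y = x * S y"
  by (simp add: multiplier_def)

lemma multiplier_shift: "multiplier S \<Longrightarrow> multiplier (op_shift S \<mu>)"
  by (simp add: multiplier_def op_shift_def left_diff_distrib right_diff_distrib
      mult_scaleC_left mult_scaleC_right)

context
  assumes ss: "semisimple TYPE('a::complex_comm_banach_algebra)"
begin

lemma quasinilpotent_eq_0:
  fixes y :: 'a
  assumes "\<And>a. summable (\<lambda>n. norm ((((*) (a * y)) ^^ n) (a * y)))"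
  shows "y = 0"
proof -
  have "jacobson_radical = {0::'a}" using ss by (simp only: semisimple_def)
  then show ?thesis using quasinilpotent_in_radical[OF assms] by blast
qed

text \<open>Every multiple \<open>a * x\<close> also has square 0, so the series required for the
  radical are finite sums.\<close>

lemma square_eq_0:
  fixes x :: 'a
  assumes "x * x = 0"
  shows "x = 0"
proof (rule quasinilpotent_eq_0)
  fix a
  have "(((*) (a * x)) ^^ n) (a * x) = 0" if "n \<noteq> 0" for n
  proof -
    obtain m where "n = Suc m" using \<open>n \<noteq> 0\<close> not0_implies_Suc by blast
    moreover have "(((*) (a * x)) ^^ Suc m) (a * x) = 0" for m
    proof (induction m)
      case 0
      have "(a * x) * (a * x) = a * a * (x * x)" by (simp only: ac_simps)
      then show ?case using assms by simp
    next
      case (Suc m)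
      then show ?case by (metis funpow.simps(2) o_apply mult_zero_right)
    qed
    ultimately show ?thesis by blast
  qed
  then show "summable (\<lambda>n. norm ((((*) (a * x)) ^^ n) (a * x)))"
    by (intro summable_finite[of "{0}"]) auto
qed

text \<open>Testing with \<open>z = x - y\<close> produces a zero square. Identities for
  multipliers, linearity included, are checked by multiplying with \<open>z\<close> and moving the
  multiplier across.\<close>

lemma annihilator_eq_0:
  fixes x y :: 'a
  assumes "\<And>z. x * z = y * z"
  shows "x = y"
  using square_eq_0[of "x - y"] assms[of "x - y"] by (simp add: left_diff_distrib)

context
  fixes S :: "'a \<Rightarrow> 'a"
  assumes S: "multiplier S"
begin

lemma multiplier_mult: "S (x * y) = S x * y" "S (x * y) = x * S y"
proof -
  show "S (x * y) = S x * y"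
  proof (rule annihilator_eq_0)
    fix z
    show "S (x * y) * z = S x * y * z"
      by (metis multiplier_swap[OF S] mult.assoc mult.commute)
  qed
  then show "S (x * y) = x * S y" by (simp add: multiplier_swap[OF S])
qed

lemma multiplier_add: "S (x + y) = S x + S y"
  by (rule annihilator_eq_0) (simp add: multiplier_swap[OF S] distrib_right)

lemma multiplier_scaleC: "S (c *\<^sub>C x) = c *\<^sub>C S x"
  by (rule annihilator_eq_0) (simp add: multiplier_swap[OF S] mult_scaleC_left)

lemma multiplier_scaleR: "S (c *\<^sub>R x) = c *\<^sub>R S x"
  by (simp add: scaleR_scaleC multiplier_scaleC)

lemma multiplier_0: "S 0 = 0"
  using multiplier_add[of 0 0] by simp

lemma multiplier_diff: "S (x - y) = S x - S y"
  using multiplier_add[of "x - y" y] by simp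

text \<open>The graph is closed because \<open>S (X n) * z = X n * S z\<close>, whose limit is
  \<open>x * S z = S x * z\<close>.\<close>

lemma multiplier_bounded_linear: "bounded_linear S"
proof (rule closed_graph_theorem)
  show "linear S"
    by (rule linearI) (simp_all add: multiplier_add multiplier_scaleR)
next
  fix X x y assume X: "X \<longlonglongrightarrow> x" and SX: "(\<lambda>n. S (X n)) \<longlonglongrightarrow> y"
  show "S x = y"
  proof (rule annihilator_eq_0)
    fix z
    have "(\<lambda>n. S (X n) * z) \<longlonglongrightarrow> y * z" "(\<lambda>n. X n * S z) \<longlonglongrightarrow> x * S z"
      by (intro tendsto_intros X SX)+
    then show "S x * z = y * z"
      using LIMSEQ_unique by (simp add: multiplier_swap[OF S])
  qed
qed

lemma multiplier_bounded_clinear: "bounded_clinear S"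
  by (simp add: bounded_clinear_def multiplier_bounded_linear multiplier_scaleC)

lemma multiplier_kernel_square:
  assumes "S (S x) = 0"
  shows "S x = 0"
proof (rule square_eq_0)
  show "S x * S x = 0" using assms by (simp add: multiplier_swap[OF S])
qed

lemma multiplier_kernel_range: "{x. S x = 0} \<inter> range S = {0}"
  using multiplier_kernel_square multiplier_0 by (auto intro: image_eqI[of 0 S 0])

lemma multiplier_kernel_pow:
  assumes "(S ^^ n) x = 0" "n > 0"
  shows "S x = 0"
  using assms
proof (induction n)
  case (Suc n)
  show ?case
  proof (cases n)
    case (Suc m)
    then have "S ((S ^^ n) x) = 0" "(S ^^ n) x = S ((S ^^ m) x)" using Suc.prems by simp_all
    then have "(S ^^ n) x = 0" using multiplier_kernel_square by metis
    then show ?thesis using Suc.IH Suc by simp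
  qed (use Suc in simp)
qed simp

lemma multiplier_subspace_kernel: "complex_vector.subspace {x. S x = 0}"
  by (rule complex_vector.subspaceI) (auto simp: multiplier_0 multiplier_add multiplier_scaleC)

lemma multiplier_subspace_image:
  assumes "complex_vector.subspace V"
  shows "complex_vector.subspace (S ` V)"
proof (rule complex_vector.subspaceI)
  show "0 \<in> S ` V"
    using complex_vector.subspace_0[OF assms] multiplier_0 by (auto intro: image_eqI[of 0 S 0])
next
  fix x y assume "x \<in> S ` V" "y \<in> S ` V"
  then show "x + y \<in> S ` V"
    using complex_vector.subspace_add[OF assms] by (auto simp flip: multiplier_add)
next
  fix c x assume "x \<in> S ` V"
  then show "c *\<^sub>C x \<in> S ` V"
    using complex_vector.subspace_scale[OF assms] by (auto simp flip: multiplier_scaleC)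
qed

lemma multiplier_subspace_range_pow: "complex_vector.subspace (range (S ^^ n))"
proof (induction n)
  case (Suc n)
  have "range (S ^^ Suc n) = S ` range (S ^^ n)" by (simp add: image_image)
  then show ?case using multiplier_subspace_image[OF Suc] by simp
qed (simp add: complex_vector.subspace_UNIV)

lemma multiplier_inverse:
  assumes "\<And>x. S (R x) = x" "\<And>x. R (S x) = x"
  shows "multiplier R"
  unfolding multiplier_def
proof (intro allI)
  fix x y
  show "R x * y = x * R y" using multiplier_swap[OF S, of "R x" "R y"] by (simp add: assms)
qed

end

text \<open>Under surjectivity a kernel element lies in the range as well, hence vanishes. The
  inverse is again a multiplier, so its continuity is automatic.\<close>

lemma multiplier_surj_invertible:
  fixes S :: "'a \<Rightarrow> 'a"
  assumes S: "multiplier S" and "surj S"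
  shows "op_invertible S"
proof -
  have "inj S"
  proof (rule injI)
    fix x y assume "S x = S y"
    then have "x - y \<in> {x. S x = 0} \<inter> range S"
      using \<open>surj S\<close> by (simp add: multiplier_diff[OF S])
    then show "x = y" by (simp add: multiplier_kernel_range[OF S])
  qed
  define R where "R = inv S"
  have R: "S (R x) = x" "R (S x) = x" for x
    using \<open>inj S\<close> \<open>surj S\<close> by (auto simp: R_def surj_f_inv_f)
  show ?thesis unfolding op_invertible_def
    using R multiplier_bounded_clinear[OF multiplier_inverse[OF S R]] by (intro exI[of _ R]) auto
qed

end

subsection \<open>Kernel-range decompositions\<close>

definition kernel_range_decomposition :: "('a::ab_group_add \<Rightarrow> 'a) \<Rightarrow> bool" where
  "kernel_range_decomposition S \<longleftrightarrow> (\<forall>x. \<exists>k y. S k = 0 \<and> x = k + S y)"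

context
  assumes ss: "semisimple TYPE('a::complex_comm_banach_algebra)"
begin

context
  fixes S :: "'a \<Rightarrow> 'a"
  assumes S: "multiplier S"
begin

lemmas multiplier_simps = multiplier_0[OF ss S] multiplier_add[OF ss S] multiplier_diff[OF ss S]
  multiplier_scaleC[OF ss S]

lemma kernel_mult_range:
  assumes "S k = 0"
  shows "k * S y = 0"
  using assms multiplier_swap[OF S, of k y] by simp

text \<open>The range is the annihilator of the kernel: if \<open>y = k + S g\<close> is annihilated
  by \<open>k\<close>, then \<open>k * k = 0\<close>. Being an annihilator, the range is
  closed.\<close>

lemma decomposition_range_eq:
  assumes "kernel_range_decomposition S"
  shows "range S = {y. \<forall>k. S k = 0 \<longrightarrow> k * y = 0}"
proof (intro equalityI subsetI)
  fix y assume "y \<in> range S"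
  then show "y \<in> {y. \<forall>k. S k = 0 \<longrightarrow> k * y = 0}" using kernel_mult_range by blast
next
  fix y assume y: "y \<in> {y. \<forall>k. S k = 0 \<longrightarrow> k * y = 0}"
  obtain k g where kg: "S k = 0" "y = k + S g"
    using assms unfolding kernel_range_decomposition_def by blast
  then have "k * k + k * S g = 0" using y by (simp flip: distrib_left)
  then have "k * k = 0" using kernel_mult_range[OF kg(1)] by simp
  then have "k = 0" by (rule square_eq_0[OF ss])
  then show "y \<in> range S" using kg by simp
qed

lemma decomposition_closed_range:
  assumes "kernel_range_decomposition S"
  shows "closed (range S)"
proof -
  have "closed (\<Inter>k\<in>{k. S k = 0}. {y. k * y = 0})"
    by (intro closed_INT ballI closed_Collect_eq continuous_intros)
  moreover have "(\<Inter>k\<in>{k. S k = 0}. {y. k * y = 0}) = range S"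
    unfolding decomposition_range_eq[OF assms] by auto
  ultimately show ?thesis by simp
qed

lemma decomposition_range_image:
  assumes "kernel_range_decomposition S"
  shows "S ` range S = range S"
proof (intro equalityI subsetI)
  fix y assume "y \<in> range S"
  then obtain x where x: "y = S x" by blast
  obtain k g where kg: "S k = 0" "x = k + S g"
    using assms unfolding kernel_range_decomposition_def by blast
  then show "y \<in> S ` range S" using x by (simp add: multiplier_simps)
qed auto

section \<open>Decompositions and the B-Weyl property\<close>

lemma kernel_on_range_pow:
  assumes "n > 0"
  shows "{x \<in> range (S ^^ n). S x = 0} = {0}"
proof -
  obtain m where n: "n = Suc m" using assms gr0_implies_Suc by blast
  have "range (S ^^ n) \<subseteq> range S" by (auto simp: n)
  moreover have "0 \<in> range (S ^^ n)"
    using complex_vector.subspace_0[OF multiplier_subspace_range_pow[OF ss S]] .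
  ultimately show ?thesis
    using multiplier_kernel_range[OF ss S] multiplier_simps by blast
qed

text \<open>\<open>S\<close> maps its range bijectively onto itself, so kernel and codimension are
  both trivial there. Hence the least exponent, which defines the index, is 0 or 1.\<close>

lemma decomposition_b_fredholm_at_1:
  assumes "kernel_range_decomposition S"
  shows "b_fredholm_at S 1"
proof -
  have "complex_vector.subspace (range S)"
    using multiplier_subspace_range_pow[OF ss S, of 1] by simp
  then have "finite_codim (range S) (S ` range S)"
    unfolding finite_codim_def decomposition_range_image[OF assms]
    using finite_dim_zero alg_complement_self_iff by blast
  moreover have "finite_dim {x \<in> range S. S x = 0}"
    using kernel_on_range_pow[of 1] finite_dim_zero by simp
  ultimately show ?thesis
    using decomposition_closed_range[OF assms] by (simp add: b_fredholm_at_def fredholm_on_def)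
qed

lemma decomposition_b_weyl:
  assumes dec: "kernel_range_decomposition S"
  shows "b_weyl S"
proof -
  have subR: "complex_vector.subspace (range S)"
    using multiplier_subspace_range_pow[OF ss S, of 1] by simp
  define n where "n = (LEAST n. b_fredholm_at S n)"
  have n: "b_fredholm_at S n" "n \<le> 1"
    unfolding n_def
    using decomposition_b_fredholm_at_1[OF dec] by (auto intro: LeastI Least_le)
  have "fredholm_index_on (range (S ^^ n)) S = 0"
  proof (cases "n = 0")
    case True
    \<comment> \<open>For exponent 0, the kernel and the complement chosen by \<open>codim\<close>
      both complement the range, so their dimensions agree.\<close>
    let ?K = "{x. S x = 0}"
    have fin: "finite_dim ?K" "finite_codim UNIV (range S)"
      using n(1) True by (simp_all add: b_fredholm_at_def fredholm_on_def)
    obtain U where "alg_complement UNIV (range S) U" "finite_dim U"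
      using fin(2) by (auto simp: finite_codim_def)
    then obtain U' where U': "alg_complement UNIV (range S) U'" "finite_dim U'"
      "codim UNIV (range S) = complex_vector.dim U'"
      using codim_complement[OF subR] by blast
    have U'': "complex_vector.subspace U'" "range S \<inter> U' = {0}"
      "{w + u | w u. w \<in> range S \<and> u \<in> U'} = UNIV"
      using alg_complementD[OF U'(1)] by simp_all
    have K: "complex_vector.subspace ?K" "?K \<inter> range S = {0}"
      using multiplier_subspace_kernel[OF ss S] multiplier_kernel_range[OF ss S] by auto
    have KR: "{w + u | w u. w \<in> range S \<and> u \<in> ?K} = UNIV"
    proof -
      have "x \<in> {w + u | w u. w \<in> range S \<and> u \<in> ?K}" for x
      proof -
        obtain k g where "S k = 0" "x = k + S g"
          using dec unfolding kernel_range_decomposition_def by blast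
        then have "x = S g + k \<and> S g \<in> range S \<and> k \<in> ?K" by simp
        then show ?thesis by blast
      qed
      then show ?thesis by blast
    qed
    have "complex_vector.dim ?K \<le> complex_vector.dim U'"
      using K U'' U' subR by (intro complement_dim_le(2)[of _ "range S"]) auto
    moreover have "complex_vector.dim U' \<le> complex_vector.dim ?K"
      using K U'' fin subR KR
      by (intro complement_dim_le(2)[of _ "range S"]) (simp_all add: Int_commute)
    ultimately show ?thesis
      using True U'(3) by (simp add: fredholm_index_on_def)
  next
    case False
    then have n1: "n = 1" using n(2) by simp
    have "alg_complement (range S) (range S) = (\<lambda>U. U = {0})"
      using alg_complement_self_iff[OF subR] by blast
    then have "codim (range S) (range S) = 0"
      by (simp add: codim_def dim_zero_singleton)
    moreover have "{x \<in> range S. S x = 0} = {0}" using kernel_on_range_pow[of 1] by simp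
    ultimately show ?thesis
      by (simp add: n1 fredholm_index_on_def decomposition_range_image[OF dec] dim_zero_singleton)
  qed
  then show ?thesis
    using n(1) by (auto simp: b_weyl_def b_fredholm_def b_fredholm_index_def n_def)
qed

lemma b_weyl_decomposition:
  assumes "b_weyl S"
  shows "kernel_range_decomposition S"
proof -
  define n where "n = (LEAST n. b_fredholm_at S n)"
  have "\<exists>n. b_fredholm_at S n" using assms by (simp add: b_weyl_def b_fredholm_def)
  then have "b_fredholm_at S n" unfolding n_def by (rule LeastI_ex)
  define V where "V = range (S ^^ n)"
  let ?K = "{x \<in> V. S x = 0}"
  have SV: "S ` V = range (S ^^ Suc n)" by (simp add: V_def image_image)
  have subV: "complex_vector.subspace V" "complex_vector.subspace (S ` V)"
    unfolding SV unfolding V_def by (rule multiplier_subspace_range_pow[OF ss S])+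
  have fin: "finite_dim ?K" "finite_codim V (S ` V)"
    using \<open>b_fredholm_at S n\<close> by (simp_all add: b_fredholm_at_def fredholm_on_def V_def)
  obtain U where "alg_complement V (S ` V) U" "finite_dim U"
    using fin(2) by (auto simp: finite_codim_def)
  then obtain U' where U': "alg_complement V (S ` V) U'" "finite_dim U'"
    "codim V (S ` V) = complex_vector.dim U'"
    using codim_complement[OF subV(2)] by blast
  have U'': "complex_vector.subspace U'" "(S ` V) \<inter> U' = {0}"
    "{w + u | w u. w \<in> S ` V \<and> u \<in> U'} = V"
    using alg_complementD[OF U'(1)] by simp_all
  have dims: "complex_vector.dim ?K = complex_vector.dim U'"
    using assms U'(3) by (simp add: b_weyl_def b_fredholm_index_def fredholm_index_on_def n_def V_def)
  have K: "complex_vector.subspace ?K"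
    using complex_vector.subspace_inter[OF subV(1) multiplier_subspace_kernel[OF ss S]]
    by (simp add: Int_def)
  have KW: "?K \<inter> S ` V = {0}"
    using multiplier_kernel_range[OF ss S] complex_vector.subspace_0[OF K]
      complex_vector.subspace_0[OF subV(2)] by blast
  have "U' \<subseteq> {w + k | w k. w \<in> S ` V \<and> k \<in> ?K}"
    using K subV U'' U' KW dims
    by (intro complement_dim_le(3)[of ?K "S ` V" U']) auto
  then have V: "\<exists>k g. S k = 0 \<and> v = k + S g \<and> k \<in> V \<and> g \<in> V" if "v \<in> V" for v
  proof -
    obtain w u where wu: "w \<in> S ` V" "u \<in> U'" "v = w + u" using U''(3) \<open>v \<in> V\<close> by blast
    obtain w' k where w': "w' \<in> S ` V" "k \<in> ?K" "u = w' + k"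
      using wu(2) \<open>U' \<subseteq> _\<close> by blast
    obtain g where "g \<in> V" "w + w' = S g"
      using complex_vector.subspace_add[OF subV(2) wu(1) w'(1)] by blast
    then show ?thesis using w' wu by (intro exI[of _ k] exI[of _ g]) (simp add: algebra_simps)
  qed
  show ?thesis
  proof (cases "n = 0")
    case True
    then show ?thesis
      using V by (auto simp: kernel_range_decomposition_def V_def)
  next
    case False
    \<comment> \<open>For \<open>n > 0\<close> the kernel of \<open>S\<close> on \<open>V\<close> is
      trivial, so the decomposition of \<open>V\<close> says that \<open>S\<close> maps
      \<open>V\<close> onto itself.\<close>
    have range_pow: "v \<in> (S ^^ m) ` V" if "v \<in> V" for v m
      using that
    proof (induction m arbitrary: v)
      case (Suc m)
      obtain k g where kg: "S k = 0" "v = k + S g" "k \<in> V" "g \<in> V" using V[OF Suc.prems] by blast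
      have "k = 0" using kernel_on_range_pow[of n] kg False by (auto simp: V_def)
      then show ?case using kg Suc.IH[OF kg(4)] by auto
    qed simp
    have "\<exists>k y. S k = 0 \<and> x = k + S y" for x
    proof -
      have "(S ^^ n) x \<in> V" by (simp add: V_def)
      \<comment> \<open>Replacing \<open>x\<close> by \<open>x - v\<close> lands in the kernel of
        \<open>S ^^ n\<close>, which is that of \<open>S\<close>, while \<open>v\<close> lies in the
        range of \<open>S\<close>.\<close>
      then obtain v where v: "v \<in> V" "(S ^^ n) x = (S ^^ n) v" using range_pow by blast
      have pow_diff: "(S ^^ m) (x - v) = (S ^^ m) x - (S ^^ m) v" for m
        by (induction m) (simp_all add: multiplier_simps)
      have "S (x - v) = 0"
        using multiplier_kernel_pow[OF ss S, of n "x - v"] v(2) False by (simp add: pow_diff)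
      moreover obtain y where "v = S y"
        using v(1) False by (cases n) (auto simp: V_def)
      ultimately show ?thesis by (intro exI[of _ "x - v"] exI[of _ y]) simp
    qed
    then show ?thesis by (simp add: kernel_range_decomposition_def)
  qed
qed

text \<open>\<open>G\<close> inverts \<open>S\<close> on its range and vanishes on the kernel. For
  small z, \<open>S - z\<close> is inverted on the range by a Neumann series in \<open>G\<close>,
  and on the kernel it is multiplication by -z.\<close>

lemma decomposition_isolated:
  assumes dec: "kernel_range_decomposition S"
  obtains \<epsilon> where "\<epsilon> > 0" "\<And>z. z \<noteq> 0 \<Longrightarrow> cmod z < \<epsilon> \<Longrightarrow> op_invertible (op_shift S z)"
proof -
  have "\<exists>g. g \<in> range S \<and> S (x - S g) = 0" for x
  proof -
    obtain k g where kg: "S k = 0" "x = k + S g"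
      using dec unfolding kernel_range_decomposition_def by blast
    obtain g' where "g' \<in> range S" "S g = S g'"
      using decomposition_range_image[OF dec] by (metis image_iff rangeI)
    then show ?thesis using kg by (auto simp: multiplier_simps)
  qed
  then obtain G where G: "\<And>x. G x \<in> range S" "\<And>x. S (x - S (G x)) = 0" by metis
  have "multiplier G"
    unfolding multiplier_def
  proof (intro allI)
    \<comment> \<open>\<open>y - S (G y)\<close> lies in the kernel and \<open>G x\<close> in the
      range, so their product is 0.\<close>
    have *: "G x * y = G x * S (G y)" for x y
    proof -
      have "(y - S (G y)) * G x = 0"
        using kernel_mult_range[OF G(2)[of y]] G(1)[of x] by (auto simp only: image_iff)
      then show ?thesis by (simp add: algebra_simps)
    qed
    fix x y
    show "G x * y = x * G y"
      using *[of x y] *[of y x] multiplier_swap[OF S, of "G x" "G y"] by (simp add: mult.commute)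
  qed
  then interpret G: bounded_linear G by (rule multiplier_bounded_linear[OF ss])
  interpret S: bounded_linear S by (rule multiplier_bounded_linear[OF ss S])
  have SGG: "S (G (G x)) = G x" for x
  proof -
    have "G x - S (G (G x)) \<in> range S"
      using G(1)[of x] multiplier_simps(3) by (metis (no_types, lifting) imageE rangeI)
    then have "G x - S (G (G x)) \<in> {x. S x = 0} \<inter> range S" using G(2) by blast
    then show ?thesis unfolding multiplier_kernel_range[OF ss S] by simp
  qed
  obtain M where M: "M > 0" "\<And>x. norm (G x) \<le> norm x * M" using G.pos_bounded by blast
  show thesis
  proof (rule that[of "1 / M"])
    fix z assume z: "z \<noteq> 0" "cmod z < 1 / M"
    have "surj (op_shift S z)"
    proof -
      have "\<exists>x. y = op_shift S z x" for y
      proof -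
        \<comment> \<open>The sum \<open>w\<close> of this series solves
          \<open>S w - z w = S (G y)\<close>. Its radius of convergence is at least
          \<open>1 / M\<close>, with \<open>M\<close> a bound for \<open>G\<close>.\<close>
        define h where "h n = z ^ n *\<^sub>C (G ^^ Suc n) y" for n
        have pow: "norm ((G ^^ n) y) \<le> norm y * M ^ n" for n
        proof (induction n)
          case (Suc n)
          have "norm ((G ^^ Suc n) y) \<le> norm ((G ^^ n) y) * M" using M(2) by simp
          also have "\<dots> \<le> norm y * M ^ n * M" using Suc M(1) by (intro mult_right_mono) auto
          finally show ?case by (simp add: mult_ac)
        qed simp
        have "norm (h n) \<le> (norm y * M) * (cmod z * M) ^ n" for n
        proof -
          have "norm (h n) = cmod z ^ n * norm ((G ^^ Suc n) y)"
            by (simp only: h_def norm_scaleC norm_power)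
          also have "\<dots> \<le> cmod z ^ n * (norm y * M ^ Suc n)"
            by (intro mult_left_mono pow) auto
          finally show ?thesis by (simp add: power_mult_distrib mult_ac)
        qed
        moreover have "summable (\<lambda>n. (norm y * M) * (cmod z * M) ^ n)"
          using z M(1) by (intro summable_mult summable_geometric) (simp add: field_simps)
        ultimately have sh: "summable h"
          by (intro summable_comparison_test'[of "\<lambda>n. (norm y * M) * (cmod z * M) ^ n" 0 h]) auto
        define w where "w = suminf h"
        have "(\<lambda>n. S (h n)) sums S w"
          unfolding w_def by (rule S.sums[OF summable_sums[OF sh]])
        moreover have "S (h 0) = S (G y)" by (simp add: h_def scaleC_one)
        moreover have "S (h (Suc n)) = z *\<^sub>C h n" for n
          by (simp add: h_def multiplier_simps SGG scaleC_scaleC)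
        ultimately have "(\<lambda>n. z *\<^sub>C h n) sums (S w - S (G y))"
          using sums_Suc_iff[of "\<lambda>n. S (h n)" "S w - S (G y)"] by simp
        moreover have "(\<lambda>n. z *\<^sub>C h n) sums (z *\<^sub>C w)"
        proof -
          have "bounded_linear (\<lambda>x::'a. z *\<^sub>C x)"
            by (rule bounded_linear_intro[where K = "cmod z"])
              (simp_all add: scaleC_add_right norm_scaleC scaleR_scaleC scaleC_scaleC mult.commute)
          then show ?thesis unfolding w_def by (rule bounded_linear.sums[OF _ summable_sums[OF sh]])
        qed
        ultimately have Sw: "S w - S (G y) = z *\<^sub>C w" by (rule sums_unique2)
        \<comment> \<open>The remaining part of \<open>y\<close> lies in the kernel, where dividing
          by -z solves the equation.\<close>
        define k where "k = y - S (G y)"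
        have "S k = 0" using G(2) by (simp add: k_def)
        then have "op_shift S z (w - inverse z *\<^sub>C k) = (S w - z *\<^sub>C w) + k"
          using z by (simp add: op_shift_def multiplier_simps scaleC_scaleC scaleC_one
              complex_vector.scale_right_diff_distrib)
        also have "S w - z *\<^sub>C w = S (G y)" using Sw by (simp add: algebra_simps)
        finally show ?thesis by (intro exI[of _ "w - inverse z *\<^sub>C k"]) (simp add: k_def)
      qed
      then show ?thesis unfolding surj_def by blast
    qed
    then show "op_invertible (op_shift S z)"
      by (rule multiplier_surj_invertible[OF ss multiplier_shift[OF S]])
  qed (use M in simp)
qed

end

end

subsection \<open>The resolvent around an isolated point of the spectrum\<close>

lemma bounded_bilinear_scaleC:
  "bounded_bilinear (scaleC :: complex \<Rightarrow> 'a::complex_normed_vector \<Rightarrow> 'a)"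
proof
  fix a b :: complex and x y :: 'a and r :: real
  show "(a + b) *\<^sub>C x = a *\<^sub>C x + b *\<^sub>C x" by (rule scaleC_add_left)
  show "a *\<^sub>C (x + y) = a *\<^sub>C x + a *\<^sub>C y" by (rule scaleC_add_right)
  show "(r *\<^sub>R a) *\<^sub>C x = r *\<^sub>R (a *\<^sub>C x)"
    by (simp add: scaleR_scaleC[of r "a *\<^sub>C x"] scaleC_scaleC scaleR_conv_of_real)
  show "a *\<^sub>C (r *\<^sub>R x) = r *\<^sub>R (a *\<^sub>C x)"
    by (simp add: scaleR_scaleC[of r x] scaleR_scaleC[of r "a *\<^sub>C x"] scaleC_scaleC mult.commute)
  show "\<exists>K. \<forall>a (x::'a). norm (a *\<^sub>C x) \<le> norm a * norm x * K"
    by (intro exI[of _ 1]) (simp add: norm_scaleC)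
qed

interpretation scaleC: bounded_bilinear "scaleC :: complex \<Rightarrow> 'a::complex_normed_vector \<Rightarrow> 'a"
  by (rule bounded_bilinear_scaleC)

text \<open>\<open>R z\<close> stands for (S - z)^(-1) on the punctured disc, expressed by the two
  identities; its value at 0 is unconstrained.\<close>

locale punctured_resolvent =
  fixes S :: "'a::{complex_normed_vector,banach} \<Rightarrow> 'a" and R :: "complex \<Rightarrow> 'a \<Rightarrow> 'a" and \<epsilon> :: real
  assumes S: "bounded_clinear S" and eps: "\<epsilon> > 0"
    and R: "z \<noteq> 0 \<Longrightarrow> cmod z < \<epsilon> \<Longrightarrow> bounded_clinear (R z)"
    and R_right: "z \<noteq> 0 \<Longrightarrow> cmod z < \<epsilon> \<Longrightarrow> S (R z x) = x + z *\<^sub>C R z x"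
    and R_left: "z \<noteq> 0 \<Longrightarrow> cmod z < \<epsilon> \<Longrightarrow> R z (S x) = x + z *\<^sub>C R z x"
begin

definition punctured_disc :: "complex set" where "punctured_disc = {z. z \<noteq> 0 \<and> cmod z < \<epsilon>}"

section \<open>Resolvent identity, continuity and complex derivative of the resolvent\<close>

lemma R_linear:
  assumes "z \<in> punctured_disc"
  shows "bounded_linear (R z)" "R z (c *\<^sub>C x) = c *\<^sub>C R z x"
    "R z (x + y) = R z x + R z y" "R z (x - y) = R z x - R z y"
proof -
  show *: "bounded_linear (R z)" and "R z (c *\<^sub>C x) = c *\<^sub>C R z x"
    using R assms by (auto simp: punctured_disc_def bounded_clinear_def)
  interpret bounded_linear "R z" by fact
  show "R z (x + y) = R z x + R z y" "R z (x - y) = R z x - R z y" by (rule add diff)+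
qed

lemma S_linear: "bounded_linear S" "S (c *\<^sub>C x) = c *\<^sub>C S x" "S (x + y) = S x + S y"
  using S by (auto simp: bounded_clinear_def linear_simps)

lemma open_punctured_disc: "open punctured_disc"
proof -
  have "punctured_disc = ball 0 \<epsilon> - {0}" by (auto simp: punctured_disc_def)
  then show ?thesis by (simp add: open_delete)
qed

text \<open>Evaluate \<open>R w (S (R z x))\<close> in two ways, with \<open>S\<close> absorbed by
  the left or by the right resolvent.\<close>

lemma resolvent_identity:
  assumes "w \<in> punctured_disc" "z \<in> punctured_disc"
  shows "R w x - R z x = (w - z) *\<^sub>C R w (R z x)"
proof -
  have "R w (S (R z x)) = R z x + w *\<^sub>C R w (R z x)"
    using assms R_left by (simp add: punctured_disc_def)
  moreover have "R w (S (R z x)) = R w x + z *\<^sub>C R w (R z x)"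
    using assms R_right[of z x] R_linear[OF assms(1)] by (simp add: punctured_disc_def)
  ultimately show ?thesis by (simp add: scaleC.diff_left algebra_simps)
qed

text \<open>Near \<open>z\<close> the resolvent identity bounds the operator norm of
  \<open>R w\<close> by \<open>K\<close> plus half of itself; absorbing that half leaves
  \<open>2 * K\<close>.\<close>

lemma resolvent_locally_bounded:
  assumes z: "z \<in> punctured_disc"
  obtains K where "\<forall>\<^sub>F w in at z. w \<in> punctured_disc \<and> (\<forall>y. norm (R w y) \<le> K * norm y)"
proof -
  obtain K where K: "K > 0" "\<And>y. norm (R z y) \<le> norm y * K"
    using bounded_linear.pos_bounded[OF R_linear(1)[OF z]] by blast
  have "\<forall>\<^sub>F w in at z. w \<in> punctured_disc"
    using open_punctured_disc z by (rule eventually_at_in_open')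
  moreover have "\<forall>\<^sub>F w in at z. dist w z < 1 / (2 * K)"
    using K by (intro tendstoD[OF tendsto_ident_at]) simp
  ultimately have "\<forall>\<^sub>F w in at z. w \<in> punctured_disc \<and> (\<forall>y. norm (R w y) \<le> (2 * K) * norm y)"
  proof eventually_elim
    case (elim w)
    have wz: "cmod (w - z) * K \<le> 1 / 2"
      using elim(2) K(1) by (simp add: dist_norm field_simps)
    let ?k = "onorm (R w)"
    note blin = R_linear(1)[OF elim(1)]
    have "norm (R w y) \<le> (K + ?k / 2) * norm y" for y
    proof -
      have "R w y = R z y + (w - z) *\<^sub>C R w (R z y)"
        using resolvent_identity[OF elim(1) z, of y] by (simp add: algebra_simps)
      then have "norm (R w y) \<le> norm (R z y) + cmod (w - z) * norm (R w (R z y))"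
        by (metis norm_triangle_ineq norm_scaleC)
      also have "\<dots> \<le> norm y * K + cmod (w - z) * (?k * (norm y * K))"
        using K(2)[of y] onorm_pos_le[OF blin]
        by (intro add_mono mult_left_mono order_trans[OF onorm[OF blin]]) auto
      also have "\<dots> = norm y * K + (cmod (w - z) * K) * (?k * norm y)" by (simp add: mult_ac)
      also have "\<dots> \<le> norm y * K + (1 / 2) * (?k * norm y)"
        using onorm_pos_le[OF blin] K(1) by (intro add_mono mult_right_mono wz) auto
      finally show ?thesis by (simp add: algebra_simps)
    qed
    then have "?k \<le> K + ?k / 2"
      using onorm_pos_le[OF blin] K(1) by (intro onorm_bound) auto
    then have "?k \<le> 2 * K" by simp
    then have "norm (R w y) \<le> (2 * K) * norm y" for y
      using order_trans[OF onorm[OF blin, of y] mult_right_mono] by auto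
    then show ?case using elim(1) by blast
  qed
  then show ?thesis by (rule that)
qed

text \<open>The argument \<open>f w\<close> varies too, so that the lemma also covers the nested
  \<open>R w (R w x)\<close> in the derivative.\<close>

lemma isCont_resolvent:
  assumes z: "z \<in> punctured_disc" and f: "isCont f z"
  shows "isCont (\<lambda>w. R w (f w)) z"
proof -
  obtain K where K: "\<forall>\<^sub>F w in at z. w \<in> punctured_disc \<and> (\<forall>y. norm (R w y) \<le> K * norm y)"
    using resolvent_locally_bounded[OF z] .
  let ?b = "\<lambda>w. K * norm (f w - f z) + cmod (w - z) * (K * norm (R z (f z)))"
  have "((\<lambda>w. R w (f w) - R z (f z)) \<longlongrightarrow> 0) (at z)"
  proof (rule Lim_null_comparison)
    show "\<forall>\<^sub>F w in at z. norm (R w (f w) - R z (f z)) \<le> ?b w"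
      using K
    proof eventually_elim
      case (elim w)
      have "R w (f w) - R z (f z) = R w (f w - f z) + (w - z) *\<^sub>C R w (R z (f z))"
        using resolvent_identity[of w z "f z"] elim z by (simp add: R_linear(4) algebra_simps)
      then have "norm (R w (f w) - R z (f z)) \<le> norm (R w (f w - f z)) + norm ((w - z) *\<^sub>C R w (R z (f z)))"
        by (metis norm_triangle_ineq)
      also have "\<dots> \<le> ?b w"
        unfolding norm_scaleC using elim by (intro add_mono mult_left_mono) auto
      finally show ?case .
    qed
    have "(?b \<longlongrightarrow> K * norm (f z - f z) + cmod (z - z) * (K * norm (R z (f z)))) (at z)"
      by (intro tendsto_intros f[unfolded isCont_def])
    then show "(?b \<longlongrightarrow> 0) (at z)" by simp
  qed
  then show ?thesis unfolding isCont_def using Lim_null by blast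
qed

text \<open>By the resolvent identity the normalised error is exactly the norm of
  \<open>R w (R z x) - R z (R z x)\<close>, which tends to 0 by continuity.\<close>

lemma resolvent_has_derivative:
  assumes z: "z \<in> punctured_disc"
  shows "((\<lambda>w. R w x) has_derivative (\<lambda>h. h *\<^sub>C R z (R z x))) (at z)"
  unfolding has_derivative_iff_norm
proof
  show "bounded_linear (\<lambda>h. h *\<^sub>C R z (R z x))" by (rule scaleC.bounded_linear_left)
  have "isCont (\<lambda>w. R w (R z x)) z" by (intro isCont_resolvent z) simp
  then have "((\<lambda>w. norm (R w (R z x) - R z (R z x))) \<longlongrightarrow> norm (R z (R z x) - R z (R z x))) (at z)"
    unfolding isCont_def by (intro tendsto_intros)
  then have "((\<lambda>w. norm (R w (R z x) - R z (R z x))) \<longlongrightarrow> 0) (at z)" by simp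
  moreover have "\<forall>\<^sub>F w in at z. norm (R w (R z x) - R z (R z x)) =
      norm (R w x - R z x - (w - z) *\<^sub>C R z (R z x)) / norm (w - z)"
  proof -
    have "\<forall>\<^sub>F w in at z. w \<in> punctured_disc" using open_punctured_disc z by (rule eventually_at_in_open')
    moreover have "\<forall>\<^sub>F w in at z. w \<noteq> z" by (rule eventually_neq_at_within)
    ultimately show ?thesis
    proof eventually_elim
      case (elim w)
      have "R w x - R z x - (w - z) *\<^sub>C R z (R z x) = (w - z) *\<^sub>C (R w (R z x) - R z (R z x))"
        using resolvent_identity[OF elim(1) z, of x] by (simp add: scaleC.diff_right)
      then show ?case using elim(2) by (simp add: norm_scaleC)
    qed
  qed
  ultimately show "((\<lambda>w. norm (R w x - R z x - (w - z) *\<^sub>C R z (R z x)) / norm (w - z)) \<longlongrightarrow> 0) (at z)"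
    by (rule Lim_transform_eventually)
qed

section \<open>Powers of z times the resolvent, integrated over circles\<close>

definition laurent :: "'a \<Rightarrow> nat \<Rightarrow> complex \<Rightarrow> 'a" where
  "laurent x j z = z ^ j *\<^sub>C R z x"

text \<open>The complex derivative of \<open>laurent\<close>. For \<open>j = 0\<close> the truncated
  exponent \<open>j - 1\<close> is harmless, since its coefficient is 0.\<close>

definition laurent' :: "'a \<Rightarrow> nat \<Rightarrow> complex \<Rightarrow> 'a" where
  "laurent' x j z = z ^ j *\<^sub>C R z (R z x) + (of_nat j * z ^ (j - 1)) *\<^sub>C R z x"

lemma isCont_laurent:
  "z \<in> punctured_disc \<Longrightarrow> isCont (laurent x j) z"
  "z \<in> punctured_disc \<Longrightarrow> isCont (laurent' x j) z"
  unfolding laurent_def [abs_def] laurent'_def [abs_def]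
  by (intro isCont_add scaleC.isCont isCont_resolvent continuous_intros; simp)+

lemma continuous_on_laurent: "continuous_on punctured_disc (laurent x j)" "continuous_on punctured_disc (laurent' x j)"
  by (intro continuous_at_imp_continuous_on ballI isCont_laurent; assumption)+

lemma laurent_has_derivative:
  assumes z: "z \<in> punctured_disc"
  shows "(laurent x j has_derivative (\<lambda>h. h *\<^sub>C laurent' x j z)) (at z)"
proof -
  have "((\<lambda>z. z ^ j) has_derivative (\<lambda>h. h * (of_nat j * z ^ (j - 1)))) (at z)"
    by (auto intro!: derivative_eq_intros simp: mult_ac)
  from scaleC.FDERIV[OF this resolvent_has_derivative[OF z, of x]]
  have "(laurent x j has_derivative (\<lambda>h. z ^ j *\<^sub>C h *\<^sub>C R z (R z x) +
      (h * (of_nat j * z ^ (j - 1))) *\<^sub>C R z x)) (at z)"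
    by (simp add: laurent_def [abs_def])
  then show ?thesis
    by (simp add: laurent'_def scaleC_add_right scaleC_scaleC mult_ac)
qed

lemma laurent_path_derivative:
  assumes "(\<gamma> has_vector_derivative d) (at t within U)" "\<gamma> t \<in> punctured_disc"
  shows "((\<lambda>t. laurent x j (\<gamma> t)) has_vector_derivative d *\<^sub>C laurent' x j (\<gamma> t)) (at t within U)"
proof -
  have "((\<lambda>t. laurent x j (\<gamma> t)) has_derivative (\<lambda>s. (s *\<^sub>R d) *\<^sub>C laurent' x j (\<gamma> t))) (at t within U)"
    using has_derivative_compose[OF assms(1)[unfolded has_vector_derivative_def] laurent_has_derivative[OF assms(2)]] .
  then show ?thesis by (simp add: has_vector_derivative_def scaleC.scaleR_left)
qed

text \<open>With the logarithm of the radius as parameter, the radial and angular derivatives are z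
  and iz, differing only by the factor i.\<close>

definition circle :: "real \<Rightarrow> real \<Rightarrow> complex" where
  "circle t \<theta> = exp (of_real t + \<i> * of_real \<theta>)"

lemma circle_in_punctured_disc: "t < ln \<epsilon> \<Longrightarrow> circle t \<theta> \<in> punctured_disc"
  using eps exp_less_cancel_iff[of t "ln \<epsilon>"] by (simp add: punctured_disc_def circle_def del: exp_less_cancel_iff)

lemma norm_circle: "cmod (circle t \<theta>) = exp t"
  by (simp add: circle_def)

lemma circle_has_vector_derivative: "((\<lambda>t. circle t \<theta>) has_vector_derivative circle t \<theta>) (at t within U)"
  "((\<lambda>\<theta>. circle t \<theta>) has_vector_derivative \<i> * circle t \<theta>) (at \<theta> within V)"
proof -
  have "((\<lambda>t. of_real t + \<i> * of_real \<theta>) has_vector_derivative 1) (at t within U)"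
    by (auto intro!: derivative_eq_intros)
  from field_vector_diff_chain_within[OF this has_field_derivative_at_within[OF DERIV_exp]]
  show "((\<lambda>t. circle t \<theta>) has_vector_derivative circle t \<theta>) (at t within U)"
    by (simp add: o_def circle_def)
  have "((\<lambda>\<theta>. of_real t + \<i> * of_real \<theta>) has_vector_derivative \<i>) (at \<theta> within V)"
    by (auto intro!: derivative_eq_intros)
  from field_vector_diff_chain_within[OF this has_field_derivative_at_within[OF DERIV_exp]]
  show "((\<lambda>\<theta>. circle t \<theta>) has_vector_derivative \<i> * circle t \<theta>) (at \<theta> within V)"
    by (simp add: o_def circle_def)
qed

lemma continuous_on_circle: "continuous_on A (\<lambda>p. circle (fst p) (snd p))" "continuous_on B (circle t)"
  unfolding circle_def [abs_def] by (intro continuous_intros)+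

lemma circle_periodic: "circle t (2 * pi) = circle t 0"
  using exp_two_pi_i by (simp add: circle_def exp_add mult.commute mult.left_commute)

lemma continuous_on_laurent_circle:
  assumes "t < ln \<epsilon>"
  shows "continuous_on A (\<lambda>\<theta>. laurent x j (circle t \<theta>))"
  by (rule continuous_on_compose2[OF continuous_on_laurent(1) continuous_on_circle(2)]) (use circle_in_punctured_disc[OF assms] in auto)

text \<open>Integration in the angle means integration against dz / (iz), so index \<open>j\<close>
  corresponds to the contour integral of z^(j-1) R(z) x, divided by i.\<close>

definition circle_integral :: "'a \<Rightarrow> nat \<Rightarrow> real \<Rightarrow> 'a" where
  "circle_integral x j t = integral {0..2*pi} (\<lambda>\<theta>. laurent x j (circle t \<theta>))"

lemma laurent_integrable:
  assumes "t < ln \<epsilon>"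
  shows "(\<lambda>\<theta>. laurent x j (circle t \<theta>)) integrable_on {0..2*pi}"
  by (intro integrable_continuous_interval continuous_on_laurent_circle assms)

text \<open>By the Cauchy-Riemann equations the radial derivative is \<open>-\<i>\<close> times the angular one.\<close>

lemma radial_derivative_integral:
  assumes "t < ln \<epsilon>"
  shows "integral {0..2*pi} (\<lambda>\<theta>. circle t \<theta> *\<^sub>C laurent' x j (circle t \<theta>)) = 0"
proof -
  have "((\<lambda>\<theta>. (\<i> * circle t \<theta>) *\<^sub>C laurent' x j (circle t \<theta>)) has_integral (laurent x j (circle t (2*pi)) - laurent x j (circle t 0))) {0..2*pi}"
    by (intro fundamental_theorem_of_calculus laurent_path_derivative circle_has_vector_derivative circle_in_punctured_disc assms) simp
  from has_integral_linear[OF this scaleC.bounded_linear_right[of "- \<i>"]]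
  have "((\<lambda>\<theta>. (- \<i>) *\<^sub>C (\<i> * circle t \<theta>) *\<^sub>C laurent' x j (circle t \<theta>)) has_integral (- \<i>) *\<^sub>C 0) {0..2*pi}"
    by (simp only: o_def circle_periodic diff_self)
  then have "((\<lambda>\<theta>. circle t \<theta> *\<^sub>C laurent' x j (circle t \<theta>)) has_integral 0) {0..2*pi}"
    by (simp add: scaleC_scaleC scaleC.zero_right flip: mult.assoc)
  then show ?thesis by (rule integral_unique)
qed

text \<open>Differentiation under the integral sign leaves the integral of the radial derivative,
  which is 0.\<close>

lemma circle_integral_derivative:
  assumes t: "t < ln \<epsilon>"
  shows "((\<lambda>t. circle_integral x j t) has_vector_derivative 0) (at t within {..<ln \<epsilon>})"
proof -
  have "((\<lambda>t. integral (cbox 0 (2*pi)) (\<lambda>\<theta>. laurent x j (circle t \<theta>))) has_vector_derivative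
      integral (cbox 0 (2*pi)) (\<lambda>\<theta>. circle t \<theta> *\<^sub>C laurent' x j (circle t \<theta>))) (at t within {..<ln \<epsilon>})"
  proof (rule leibniz_rule_vector_derivative)
    fix t \<theta> :: real assume "t \<in> {..<ln \<epsilon>}"
    then show "((\<lambda>t. laurent x j (circle t \<theta>)) has_vector_derivative circle t \<theta> *\<^sub>C laurent' x j (circle t \<theta>)) (at t within {..<ln \<epsilon>})"
      by (intro laurent_path_derivative circle_has_vector_derivative circle_in_punctured_disc) simp
  next
    fix t :: real assume "t \<in> {..<ln \<epsilon>}"
    then show "(\<lambda>\<theta>. laurent x j (circle t \<theta>)) integrable_on cbox 0 (2*pi)"
      using laurent_integrable by simp
  next
    have "continuous_on ({..<ln \<epsilon>} \<times> cbox 0 (2*pi)) (\<lambda>p. laurent' x j (circle (fst p) (snd p)))"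
      by (rule continuous_on_compose2[OF continuous_on_laurent(2) continuous_on_circle(1)]) (auto intro: circle_in_punctured_disc)
    then show "continuous_on ({..<ln \<epsilon>} \<times> cbox 0 (2*pi)) (\<lambda>(t, \<theta>). circle t \<theta> *\<^sub>C laurent' x j (circle t \<theta>))"
      unfolding split_beta by (intro scaleC.continuous_on continuous_on_circle)
  qed (use t in auto)
  then show ?thesis
    using radial_derivative_integral[OF t] by (simp add: circle_integral_def)
qed

lemma circle_integral_radius_independent:
  assumes "s < ln \<epsilon>" "t < ln \<epsilon>"
  shows "circle_integral x j s = circle_integral x j t"
proof -
  obtain c where "\<And>u. u \<in> {..<ln \<epsilon>} \<Longrightarrow> circle_integral x j u = c"
    using has_vector_derivative_zero_constant[of "{..<ln \<epsilon>}" "circle_integral x j"] circle_integral_derivative by auto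
  then show ?thesis using assms by simp
qed

lemma power_integral:
  fixes x :: 'a
  assumes "j > 0"
  shows "((\<lambda>\<theta>. circle t \<theta> ^ j *\<^sub>C x) has_integral 0) {0..2*pi}"
proof -
  have "((\<lambda>\<theta>. circle t \<theta> ^ j) has_integral
      (circle t (2*pi) ^ j / (\<i> * of_nat j) - circle t 0 ^ j / (\<i> * of_nat j))) {0..2*pi}"
  proof (rule fundamental_theorem_of_calculus)
    fix \<theta> :: real
    have "((\<lambda>z. z ^ j / (\<i> * of_nat j)) has_field_derivative (circle t \<theta> ^ (j - 1) / \<i>)) (at (circle t \<theta>))"
      using assms by (auto intro!: derivative_eq_intros)
    from field_vector_diff_chain_within[OF circle_has_vector_derivative(2) DERIV_subset[OF this subset_UNIV]]
    have "((\<lambda>\<theta>. circle t \<theta> ^ j / (\<i> * of_nat j)) has_vector_derivative (\<i> * circle t \<theta>) * (circle t \<theta> ^ (j - 1) / \<i>))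
        (at \<theta> within {0..2*pi})"
      by (simp add: o_def)
    moreover have "(\<i> * circle t \<theta>) * (circle t \<theta> ^ (j - 1) / \<i>) = circle t \<theta> ^ j"
    proof -
      have cancel: "c * a * (b / c) = a * b" if "c \<noteq> 0" for a b c :: complex
        using that by simp
      show ?thesis using assms power_minus_mult[of j "circle t \<theta>"]
        by (simp only: cancel[OF complex_i_not_zero] mult.commute)
    qed
    ultimately show "((\<lambda>\<theta>. circle t \<theta> ^ j / (\<i> * of_nat j)) has_vector_derivative circle t \<theta> ^ j)
        (at \<theta> within {0..2*pi})"
      by metis
  qed simp
  then have "((\<lambda>\<theta>. circle t \<theta> ^ j) has_integral 0) {0..2*pi}" by (simp add: circle_periodic)
  from has_integral_linear[OF this scaleC.bounded_linear_left, of x]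
  show ?thesis by (simp add: o_def scaleC.zero_left)
qed

text \<open>Since S R(z) x = x + z R(z) x, applying \<open>S\<close> raises the index by one. The
  extra term integrates z^j x, which survives only for \<open>j = 0\<close>.\<close>

lemma apply_circle_integral:
  assumes t: "t < ln \<epsilon>"
  shows "S (circle_integral x j t) = (if j = 0 then (2 * pi) *\<^sub>R x else 0) + circle_integral x (Suc j) t"
proof -
  have "S (circle_integral x j t) = integral {0..2*pi} (S \<circ> (\<lambda>\<theta>. laurent x j (circle t \<theta>)))"
    unfolding circle_integral_def by (rule integral_linear[OF laurent_integrable[OF t] S_linear(1), symmetric])
  also have "S \<circ> (\<lambda>\<theta>. laurent x j (circle t \<theta>)) = (\<lambda>\<theta>. circle t \<theta> ^ j *\<^sub>C x + laurent x (Suc j) (circle t \<theta>))"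
  proof
    fix \<theta>
    have "S (R (circle t \<theta>) x) = x + circle t \<theta> *\<^sub>C R (circle t \<theta>) x"
      using circle_in_punctured_disc[OF t] R_right by (simp add: punctured_disc_def)
    then show "(S \<circ> (\<lambda>\<theta>. laurent x j (circle t \<theta>))) \<theta> = circle t \<theta> ^ j *\<^sub>C x + laurent x (Suc j) (circle t \<theta>)"
      by (simp add: laurent_def S_linear scaleC_add_right scaleC_scaleC mult_ac)
  qed
  also have "integral {0..2*pi} \<dots> = (if j = 0 then (2 * pi) *\<^sub>R x else 0) + circle_integral x (Suc j) t"
  proof (rule integral_unique, rule has_integral_add)
    show "((\<lambda>\<theta>. laurent x (Suc j) (circle t \<theta>)) has_integral circle_integral x (Suc j) t) {0..2*pi}"
      unfolding circle_integral_def by (rule integrable_integral[OF laurent_integrable[OF t]])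
    show "((\<lambda>\<theta>. circle t \<theta> ^ j *\<^sub>C x) has_integral (if j = 0 then (2 * pi) *\<^sub>R x else 0)) {0..2*pi}"
      using power_integral[of j t x] has_integral_const_real[of x 0 "2*pi"] by (auto simp: scaleC_one)
  qed
  finally show ?thesis .
qed

lemma norm_circle_integral:
  assumes t: "t < ln \<epsilon>"
  obtains C where "\<And>j. norm (circle_integral x j t) \<le> C * exp t ^ j"
proof -
  have "compact ((\<lambda>\<theta>. laurent x 0 (circle t \<theta>)) ` {0..2*pi})"
    by (intro compact_continuous_image continuous_on_laurent_circle t compact_Icc)
  then obtain C where C: "\<And>\<theta>. \<theta> \<in> {0..2*pi} \<Longrightarrow> norm (laurent x 0 (circle t \<theta>)) \<le> C"
    using compact_imp_bounded bounded_iff by (metis image_eqI)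
  have "norm (circle_integral x j t) \<le> (exp t ^ j * C) * (2*pi - 0)" for j
    unfolding circle_integral_def
  proof (rule integral_bound)
    fix \<theta> assume "\<theta> \<in> {0..2*pi}"
    have "norm (laurent x j (circle t \<theta>)) = exp t ^ j * norm (laurent x 0 (circle t \<theta>))"
      by (simp add: laurent_def norm_scaleC norm_power norm_circle)
    also have "\<dots> \<le> exp t ^ j * C" using C \<open>\<theta> \<in> _\<close> by (intro mult_left_mono) auto
    finally show "norm (laurent x j (circle t \<theta>)) \<le> exp t ^ j * C" .
  qed (use continuous_on_laurent_circle[OF t] in auto)
  then show ?thesis by (intro that[of "C * (2 * pi)"]) (simp add: mult_ac)
qed

text \<open>Here \<open>- q\<close> is the Riesz projection of \<open>x\<close> for the spectral
  point 0. Each application of \<open>S\<close> to \<open>q\<close> adds a factor z under the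
  integral, and the radius may be shrunk below any \<open>r\<close>.\<close>

lemma quasinilpotent_part:
  obtains p q where "S p = x + q" "\<And>r. r > 0 \<Longrightarrow> \<exists>C. \<forall>n. norm ((S ^^ n) q) \<le> C * r ^ n"
proof -
  define t0 where "t0 = ln \<epsilon> - 1"
  have t0: "t0 < ln \<epsilon>" by (simp add: t0_def)
  define p where "p = (1 / (2 * pi)) *\<^sub>R circle_integral x 0 t0"
  define q where "q = (1 / (2 * pi)) *\<^sub>R circle_integral x 1 t0"
  have sR: "S (c *\<^sub>R y) = c *\<^sub>R S y" for c y
    using S_linear(2) by (simp add: scaleR_scaleC)
  have "S p = x + q"
    using apply_circle_integral[OF t0, of x 0] by (simp add: p_def q_def sR scaleR_add_right)
  moreover have "\<exists>C. \<forall>n. norm ((S ^^ n) q) \<le> C * r ^ n" if "r > 0" for r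
  proof -
    \<comment> \<open>A radius at most \<open>r\<close> that stays inside the punctured disc; radius
      independence lets \<open>q\<close> be computed there.\<close>
    define t where "t = min t0 (ln r)"
    have t: "t < ln \<epsilon>" using t0 by (simp add: t_def)
    have r: "exp t \<le> r"
      using that by (metis t_def min.cobounded2 exp_le_cancel_iff exp_ln)
    have pow: "(S ^^ n) q = (1 / (2 * pi)) *\<^sub>R circle_integral x (Suc n) t" for n
    proof (induction n)
      case 0
      then show ?case using circle_integral_radius_independent[OF t0 t, of x 1] by (simp add: q_def)
    next
      case (Suc n)
      then show ?case using apply_circle_integral[OF t, of x "Suc n"] by (simp add: sR)
    qed
    obtain C where C: "\<And>j. norm (circle_integral x j t) \<le> C * exp t ^ j" using norm_circle_integral[OF t] by blast
    have "C \<ge> 0" using C[of 0] norm_ge_zero[of "circle_integral x 0 t"] by (simp del: norm_ge_zero)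
    have "norm ((S ^^ n) q) \<le> (1 / (2 * pi) * C * exp t) * r ^ n" for n
    proof -
      have "norm ((S ^^ n) q) = 1 / (2 * pi) * norm (circle_integral x (Suc n) t)" by (simp add: pow)
      also have "\<dots> \<le> 1 / (2 * pi) * (C * exp t ^ Suc n)" by (intro mult_left_mono C) simp
      also have "\<dots> = (1 / (2 * pi) * C * exp t) * exp t ^ n" by simp
      also have "\<dots> \<le> (1 / (2 * pi) * C * exp t) * r ^ n"
        using \<open>C \<ge> 0\<close> r by (intro mult_left_mono power_mono) auto
      finally show ?thesis .
    qed
    then show ?thesis by blast
  qed
  ultimately show ?thesis by (rule that)
qed

end

subsection \<open>Isolated points of the spectrum of a multiplier\<close>

context
  assumes ss: "semisimple TYPE('a::complex_comm_banach_algebra)"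
begin

context
  fixes S :: "'a \<Rightarrow> 'a"
  assumes S: "multiplier S"
begin

lemma isolated_decomposition:
  assumes eps: "\<epsilon> > 0"
    and inv: "\<And>z. z \<noteq> 0 \<Longrightarrow> cmod z < \<epsilon> \<Longrightarrow> op_invertible (op_shift S z)"
  shows "kernel_range_decomposition S"
proof -
  have "\<exists>R. bounded_clinear R \<and> (\<forall>x. S (R x) = x + z *\<^sub>C R x) \<and> (\<forall>x. R (S x) = x + z *\<^sub>C R x)"
    if z: "z \<noteq> 0" "cmod z < \<epsilon>" for z
  proof -
    obtain R where R: "bounded_clinear R" "R \<circ> op_shift S z = id" "op_shift S z \<circ> R = id"
      using inv[OF z] by (auto simp: op_invertible_def)
    have "S (R x) = x + z *\<^sub>C R x" for x
      using fun_cong[OF R(3), of x] by (simp add: op_shift_def algebra_simps)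
    moreover have "R (S x) = x + z *\<^sub>C R x" for x
    proof -
      have "R (S x) - z *\<^sub>C R x = R (S x - z *\<^sub>C x)"
        using R(1) by (simp add: bounded_clinear_def linear_simps)
      then show ?thesis using fun_cong[OF R(2), of x] by (simp add: op_shift_def algebra_simps)
    qed
    ultimately show ?thesis using R(1) by blast
  qed
  then obtain R where R: "\<And>z. z \<noteq> 0 \<Longrightarrow> cmod z < \<epsilon> \<Longrightarrow> bounded_clinear (R z)"
    "\<And>z x. z \<noteq> 0 \<Longrightarrow> cmod z < \<epsilon> \<Longrightarrow> S (R z x) = x + z *\<^sub>C R z x"
    "\<And>z x. z \<noteq> 0 \<Longrightarrow> cmod z < \<epsilon> \<Longrightarrow> R z (S x) = x + z *\<^sub>C R z x"
    by metis
  interpret resolvent: punctured_resolvent S R \<epsilon>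
    by unfold_locales (use R eps multiplier_bounded_clinear[OF ss S] in auto)
  have "\<exists>k y. S k = 0 \<and> x = k + S y" for x
  proof -
    obtain p q where p: "S p = x + q"
      and q: "\<And>r. r > 0 \<Longrightarrow> \<exists>C. \<forall>n. norm ((S ^^ n) q) \<le> C * r ^ n"
      using resolvent.quasinilpotent_part[of x] by blast
    have "S q = 0"
    proof (rule quasinilpotent_eq_0[OF ss])
      fix a
      define d where "d = a * q"
      \<comment> \<open>Multiplying by \<open>a * S q\<close> is multiplying by \<open>d\<close>
        after applying \<open>S\<close>, so the copies of \<open>S\<close> accumulate on
        \<open>q\<close>.\<close>
      have pow: "((*) (a * S q) ^^ n) (a * S q) = ((*) d ^^ n) (a * (S ^^ Suc n) q)" for n
      proof (induction n)
        case (Suc n)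
        have shift: "S (((*) d ^^ n) v) = ((*) d ^^ n) (S v)" for v
          by (induction n) (simp_all add: multiplier_mult(2)[OF ss S])
        have "(a * S q) * v = d * S v" for v
          using multiplier_swap[OF S, of q v] by (simp add: d_def mult.assoc)
        then show ?case
          using Suc by (simp add: shift multiplier_mult(2)[OF ss S])
      qed simp
      have norm_pow: "norm (((*) d ^^ n) v) \<le> norm d ^ n * norm v" for n v
      proof (induction n)
        case (Suc n)
        have "norm (((*) d ^^ Suc n) v) \<le> norm d * norm (((*) d ^^ n) v)"
          by (simp add: norm_mult_ineq)
        also have "\<dots> \<le> norm d * (norm d ^ n * norm v)" by (intro mult_left_mono Suc) simp
        finally show ?case by (simp add: mult.assoc)
      qed simp
      \<comment> \<open>Chosen so that \<open>norm d * r < 1\<close>; the summand 1 also excludes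
        division by 0.\<close>
      define r where "r = 1 / (norm d + 1)"
      have "r > 0" by (simp add: r_def add_nonneg_pos)
      have dr: "norm d * r < 1"
        by (simp add: r_def divide_less_eq_1 add_nonneg_pos)
      obtain C where C: "\<And>n. norm ((S ^^ n) q) \<le> C * r ^ n" using q[OF \<open>r > 0\<close>] by blast
      have bound: "norm (((*) (a * S q) ^^ n) (a * S q)) \<le> (norm a * C * r) * (norm d * r) ^ n" for n
      proof -
        have "norm (((*) (a * S q) ^^ n) (a * S q)) \<le> norm d ^ n * norm (a * (S ^^ Suc n) q)"
          unfolding pow by (rule norm_pow)
        also have "\<dots> \<le> norm d ^ n * (norm a * norm ((S ^^ Suc n) q))"
          by (intro mult_left_mono norm_mult_ineq) simp
        also have "\<dots> \<le> norm d ^ n * (norm a * (C * r ^ Suc n))"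
          by (intro mult_left_mono C) simp_all
        finally show ?thesis by (simp add: power_mult_distrib mult_ac)
      qed
      have geometric: "summable (\<lambda>n. (norm a * C * r) * (norm d * r) ^ n)"
        using dr \<open>r > 0\<close> by (intro summable_mult summable_geometric) simp
      show "summable (\<lambda>n. norm (((*) (a * S q) ^^ n) (a * S q)))"
        by (rule summable_comparison_test'[OF geometric, of 0])
          (simp only: real_norm_def abs_norm_cancel bound)
    qed
    then have "S (- q) = 0" using multiplier_diff[OF ss S, of 0 q] multiplier_0[OF ss S] by simp
    moreover have "x = - q + S p" using p by simp
    ultimately show ?thesis by blast
  qed
  then show ?thesis by (simp add: kernel_range_decomposition_def)
qed

lemma invertible_decomposition:
  assumes "op_invertible S"
  shows "kernel_range_decomposition S"
proof -
  obtain R where "S \<circ> R = id" using assms by (auto simp: op_invertible_def)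
  then have "x = 0 + S (R x)" for x by (simp add: pointfree_idE)
  then show ?thesis using multiplier_0[OF ss S] unfolding kernel_range_decomposition_def by blast
qed

lemma decomposition_injective_invertible:
  assumes "kernel_range_decomposition S" and "\<And>k. S k = 0 \<Longrightarrow> k = 0"
  shows "op_invertible S"
proof (rule multiplier_surj_invertible[OF ss S])
  show "surj S"
    unfolding surj_def using assms unfolding kernel_range_decomposition_def by (metis add_0)
qed

end

end

section \<open>Generalized Weyl's theorem, by comparing the spectra point by point\<close>

theorem proposition3p3:
  fixes T :: "'a::complex_comm_banach_algebra \<Rightarrow> 'a"
  assumes "semisimple TYPE('a)"
    and "multiplier T"
  shows "generalized_weyl T"
proof -
  note ss = assms(1) and T = assms(2)
  have "b_weyl (op_shift T \<mu>) \<longleftrightarrow> op_invertible (op_shift T \<mu>) \<or> \<mu> \<in> isolated_eigenvalues T" for \<mu>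
  proof -
    let ?S = "op_shift T \<mu>"
    have S: "multiplier ?S" using T by (rule multiplier_shift)
    have shift: "op_shift ?S z = op_shift T (\<mu> + z)" for z
      by (simp add: op_shift_def fun_eq_iff scaleC_add_left algebra_simps)
    have ker: "?S k = 0 \<longleftrightarrow> T k = \<mu> *\<^sub>C k" for k by (simp add: op_shift_def)
    \<comment> \<open>Isolation of a spectral point becomes invertibility of all small nonzero
      shifts of \<open>?S\<close>, the form used by the decomposition lemmas.\<close>
    have iso: "\<mu> isolated_in op_spectrum T \<longleftrightarrow> \<not> op_invertible ?S \<and>
        (\<exists>\<epsilon>>0. \<forall>z. z \<noteq> 0 \<longrightarrow> cmod z < \<epsilon> \<longrightarrow> op_invertible (op_shift ?S z))"
    proof -
      have "(\<forall>y\<in>op_spectrum T. dist \<mu> y < e \<longrightarrow> y = \<mu>) \<longleftrightarrow>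
          (\<forall>z. z \<noteq> 0 \<longrightarrow> cmod z < e \<longrightarrow> op_invertible (op_shift ?S z))" (is "?L \<longleftrightarrow> ?R") for e
      proof
        assume L: ?L
        show ?R
        proof (intro allI impI)
          fix z assume z: "z \<noteq> 0" "cmod z < e"
          then have "\<mu> + z \<notin> op_spectrum T" using L by (auto simp: dist_norm)
          then show "op_invertible (op_shift ?S z)" by (simp add: op_spectrum_def shift)
        qed
      next
        assume R: ?R
        show ?L
        proof (intro ballI impI)
          fix y assume y: "y \<in> op_spectrum T" "dist \<mu> y < e"
          have "\<not> op_invertible (op_shift ?S (y - \<mu>))" using y(1) by (simp add: op_spectrum_def shift)
          moreover have "cmod (y - \<mu>) < e" using y(2) by (simp add: dist_norm norm_minus_commute)
          ultimately show "y = \<mu>" using R by (metis right_minus_eq)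
        qed
      qed
      then show ?thesis by (auto simp: isolated_in_dist_Ex_iff op_spectrum_def)
    qed
    show ?thesis
    proof
      assume "b_weyl ?S"
      then have dec: "kernel_range_decomposition ?S" by (rule b_weyl_decomposition[OF ss S])
      show "op_invertible ?S \<or> \<mu> \<in> isolated_eigenvalues T"
      proof (cases "op_invertible ?S")
        case False
        \<comment> \<open>With a decomposition, failure of invertibility can only come from a
          nonzero kernel.\<close>
        then have "eigenvalue T \<mu>"
          using decomposition_injective_invertible[OF ss S dec] ker by (auto simp: eigenvalue_def)
        moreover have "\<mu> isolated_in op_spectrum T"
          unfolding iso using decomposition_isolated[OF ss S dec] False by metis
        ultimately show ?thesis by (simp add: isolated_eigenvalues_def)
      qed simp
    next
      assume "op_invertible ?S \<or> \<mu> \<in> isolated_eigenvalues T"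
      then have "kernel_range_decomposition ?S"
        using invertible_decomposition[OF ss S] isolated_decomposition[OF ss S] iso
        by (auto simp: isolated_eigenvalues_def)
      then show "b_weyl ?S" by (rule decomposition_b_weyl[OF ss S])
    qed
  qed
  then show ?thesis
    by (auto simp: generalized_weyl_def b_weyl_spectrum_def op_spectrum_def)
qed

end
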